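(* Let $w\in A_\infty$ be a weight on $\mathbb{R}^n$. Then $\log w\in\operatorname{BMO}_w$ and $$\|\log w\|_{\operatorname{BMO}_w}\le2^{n+3}\big([w]_{A_\infty}-1\big).$$ In addition, for each cube $Q$, $$\frac1{w(Q)}\int_Q|\log w(x)-(\log w)_{Q,w}|\,w(x)\,dx\le2^{n+3}\left(\frac1{w(Q)}\int_Q M(w\chi_Q)\,dx-1\right).$$
   Context: Cubes $Q\subset\mathbb{R}^n$ have sides parallel to the coordinate axes. A weight is a locally integrable function $w$ on $\mathbb{R}^n$ with $0<w(x)<\infty$ for a.e. $x$; $w(Q)=\int_Q w\,dx$. For $1<p<\infty$, $w\in A_p$ means $\sup_Q\left(\frac1{|Q|}\int_Q w\right)\left(\frac1{|Q|}\int_Q w^{1-p'}\right)^{p-1}<\infty$, $p'=p/(p-1)$; $w\in A_1$ means $\sup_Q\left(\frac1{|Q|}\int_Q w\right)\operatorname{ess\,sup}_Q (w^{-1})<\infty$. $A_\infty:=\bigcup_{p\ge1}A_p$; equivalently $w\in A_\infty$ iff the Fujii--Wilson constant $[w]_{A_\infty}:=\sup_Q\frac1{w(Q)}\int_Q M(w\chi_Q)\,dx$ is finite, where $Mf(x)=\sup_{Q\ni x}\frac1{|Q|}\int_Q|f|$ (supremum over cubes containing $x$). The weighted space $\operatorname{BMO}_w$ consists of $f\in L^1_{\rm loc}(w\,dx)$ with $\|f\|_{\operatorname{BMO}_w}:=\sup_Q\frac1{w(Q)}\int_Q|f-f_{Q,w}|\,w\,dx<\infty$, where $f_{Q,w}=\frac1{w(Q)}\int_Q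 f\,w\,dx$. *)

theory Defs
  imports "HOL-Analysis.Analysis" "HOL-Probability.Essential_Supremum"
begin

definition cubes :: "(real^'n) set set" where
  "cubes = {cbox a (a + (\<chi> i. h)) | a h. 0 < h}"

definition loc_integrable :: "(real^'n) measure \<Rightarrow> (real^'n \<Rightarrow> real) \<Rightarrow> bool" where
  "loc_integrable M f \<longleftrightarrow> (\<forall>K. compact K \<longrightarrow> set_integrable M K f)"

definition is_weight :: "(real^'n \<Rightarrow> real) \<Rightarrow> bool" where
  "is_weight w \<longleftrightarrow> loc_integrable lebesgue w \<and> (AE x in lebesgue. 0 < w x)"

text \<open>The measure $w\,dx$; thus \<open>emeasure (wmeasure w) Q\<close> is $w(Q)$.\<close>

definition wmeasure :: "(real^'n \<Rightarrow> real) \<Rightarrow> (real^'n) measure" where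
  "wmeasure w = density lebesgue (\<lambda>x. ennreal (w x))"

definition avg :: "(real^'n) set \<Rightarrow> (real^'n \<Rightarrow> ennreal) \<Rightarrow> ennreal" where
  "avg Q g = (\<integral>\<^sup>+x\<in>Q. g x \<partial>lebesgue) / emeasure lebesgue Q"

text \<open>Only used with a positive exponent \<open>a\<close>.\<close>

definition ennreal_powr :: "ennreal \<Rightarrow> real \<Rightarrow> ennreal" where
  "ennreal_powr x a = (if x = \<infinity> then \<infinity> else ennreal (enn2real x powr a))"

text \<open>Here $1 - p' = 1 - p/(p-1)$.\<close>

definition Ap_const :: "real \<Rightarrow> (real^'n \<Rightarrow> real) \<Rightarrow> ennreal" where
  "Ap_const p w = (SUP Q\<in>cubes. avg Q (\<lambda>x. ennreal (w x)) *
     ennreal_powr (avg Q (\<lambda>x. ennreal (w x powr (1 - p / (p - 1))))) (p - 1))"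

definition A1_const :: "(real^'n \<Rightarrow> real) \<Rightarrow> ennreal" where
  "A1_const w = (SUP Q\<in>cubes. avg Q (\<lambda>x. ennreal (w x)) *
     esssup (restrict_space lebesgue Q) (\<lambda>x. inverse (ennreal (w x))))"

definition A_class :: "real \<Rightarrow> (real^'n \<Rightarrow> real) set" where
  "A_class p = {w. is_weight w \<and> (if p = 1 then A1_const w else Ap_const p w) < \<infinity>}"

definition A_infinity :: "(real^'n \<Rightarrow> real) set" where
  "A_infinity = (\<Union>p\<in>{1..}. A_class p)"

definition maximal :: "(real^'n \<Rightarrow> real) \<Rightarrow> real^'n \<Rightarrow> ennreal" where
  "maximal f x = (SUP Q\<in>{Q\<in>cubes. x \<in> Q}. avg Q (\<lambda>y. ennreal \<bar>f y\<bar>))"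

definition fw_ratio :: "(real^'n \<Rightarrow> real) \<Rightarrow> (real^'n) set \<Rightarrow> ennreal" where
  "fw_ratio w Q =
     (\<integral>\<^sup>+x\<in>Q. maximal (\<lambda>y. w y * indicator Q y) x \<partial>lebesgue) / emeasure (wmeasure w) Q"

definition fujii_wilson :: "(real^'n \<Rightarrow> real) \<Rightarrow> ennreal" where
  "fujii_wilson w = (SUP Q\<in>cubes. fw_ratio w Q)"

definition wmean :: "(real^'n \<Rightarrow> real) \<Rightarrow> (real^'n) set \<Rightarrow> (real^'n \<Rightarrow> real) \<Rightarrow> real" where
  "wmean w Q f = (LINT x:Q|wmeasure w. f x) / measure (wmeasure w) Q"

definition wosc :: "(real^'n \<Rightarrow> real) \<Rightarrow> (real^'n) set \<Rightarrow> (real^'n \<Rightarrow> real) \<Rightarrow> ennreal" where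
  "wosc w Q f =
     (\<integral>\<^sup>+x\<in>Q. ennreal \<bar>f x - wmean w Q f\<bar> \<partial>wmeasure w) / emeasure (wmeasure w) Q"

definition bmo_norm :: "(real^'n \<Rightarrow> real) \<Rightarrow> (real^'n \<Rightarrow> real) \<Rightarrow> ennreal" where
  "bmo_norm w f = (SUP Q\<in>cubes. wosc w Q f)"

definition BMO :: "(real^'n \<Rightarrow> real) \<Rightarrow> (real^'n \<Rightarrow> real) set" where
  "BMO w = {f. loc_integrable (wmeasure w) f \<and> bmo_norm w f < \<infinity>}"

end

theory Submission
  imports Defs
begin

text \<open>
  Fix a cube \<open>Q\<close>, let \<open>l\<close> be the mean of \<open>w\<close> over \<open>Q\<close>, and let \<open>M\<^sub>k\<close> be the largest of the averages of \<open>w\<close>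
  over the dyadic subcubes of \<open>Q\<close> of levels \<open>0, \<dots>, k\<close> around a point. If \<open>M\<^sub>k < M\<^sub>k\<^sub>+\<^sub>1\<close>
  on a subcube \<open>R\<close> of level \<open>k + 1\<close>, the new value is the average of \<open>w\<close> over \<open>R\<close>, which is at most
  \<open>2\<^sup>n M\<^sub>k\<close>; hence \<open>w(R) (ln M\<^sub>k\<^sub>+\<^sub>1 - ln M\<^sub>k) \<le> 2\<^sup>n |R| (M\<^sub>k\<^sub>+\<^sub>1 - M\<^sub>k)\<close>. Summing and letting \<open>k\<close> tend to
  infinity bounds \<open>\<integral>\<^sub>Q w ln\<^sup>+ (w / l)\<close> by \<open>2\<^sup>n (\<integral>\<^sub>Q M(w \<chi>\<^sub>Q) - w(Q))\<close>. Since \<open>t ln t \<ge> t - 1\<close>, the negative part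
  \<open>\<integral>\<^sub>Q w ln\<^sup>- (w / l)\<close> is no larger, and the oscillation of \<open>ln w\<close> around its mean is at most twice that
  around \<open>ln l\<close>.

  For the finiteness of the Fujii--Wilson constant, the \<open>A\<^sub>p\<close> condition bounds the average of \<open>w\<close> over a cube
  by a multiple of the squared average of \<open>sqrt w\<close> over any comparable subset. So \<open>M(w \<chi>\<^sub>Q)\<close> is at most a multiple
  of the squared dyadic maximal function of \<open>sqrt w\<close>, and Doob's \<open>L\<^sup>2\<close> inequality applies.
\<close>

section \<open>Dyadic cells\<close>

lemma emeasure_cube:
  fixes c :: "real^'n"
  assumes "0 \<le> s"
  shows "emeasure lebesgue (cbox c (c + (\<chi> i. s))) = ennreal (s ^ CARD('n))"
proof -
  have "measure lebesgue (cbox c (c + (\<chi> i. s))) = s ^ CARD('n)"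
    using assms content_cbox_cart[of c "c + (\<chi> i. s)"]
    by (auto simp: interval_eq_empty_cart not_less)
  moreover have "emeasure lebesgue (cbox c (c + (\<chi> i. s))) \<noteq> \<infinity>"
    using emeasure_lborel_cbox_finite[of c "c + (\<chi> i. s)"] by simp
  ultimately show ?thesis
    by (simp add: emeasure_eq_ennreal_measure)
qed

locale dyadic_grid =
  fixes a :: "real^'n" and h :: real
  assumes h_pos: "0 < h"
begin

text \<open>Floors make the cells half-open, so that the cells of each level partition the whole
  space. In particular \<open>cell 0 a\<close> is the cube with lower corner \<open>a\<close> and
  side \<open>h\<close>, without its upper faces.\<close>

definition index :: "nat \<Rightarrow> real^'n \<Rightarrow> int^'n" where
  "index k x = (\<chi> i. \<lfloor>2 ^ k * ((x $ i - a $ i) / h)\<rfloor>)"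

definition cell :: "nat \<Rightarrow> real^'n \<Rightarrow> (real^'n) set" where
  "cell k x = {y. index k y = index k x}"

definition corner :: "nat \<Rightarrow> real^'n \<Rightarrow> real^'n" where
  "corner k x = (\<chi> i. a $ i + h / 2 ^ k * of_int (index k x $ i))"

lemma self_in_cell [simp]: "x \<in> cell k x"
  by (simp add: cell_def)

lemma cell_eq: "y \<in> cell k x \<Longrightarrow> cell k y = cell k x"
  by (simp add: cell_def)

lemma mem_cell_iff:
  "y \<in> cell k x \<longleftrightarrow>
    (\<forall>i. corner k x $ i \<le> y $ i \<and> y $ i < corner k x $ i + h / 2 ^ k)"
proof -
  have "\<lfloor>2 ^ k * ((y $ i - a $ i) / h)\<rfloor> = m \<longleftrightarrow>
      a $ i + h / 2 ^ k * of_int m \<le> y $ i \<and> y $ i < a $ i + h / 2 ^ k * of_int m + h / 2 ^ k"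
    for i m
    using h_pos by (simp add: floor_eq_iff field_simps)
  then show ?thesis
    by (simp add: cell_def index_def corner_def vec_eq_iff)
qed

lemma cell_subset_cbox: "cell k x \<subseteq> cbox (corner k x) (corner k x + (\<chi> i. h / 2 ^ k))"
  by (auto simp: mem_cell_iff mem_box_cart less_imp_le)

lemma box_subset_cell: "box (corner k x) (corner k x + (\<chi> i. h / 2 ^ k)) \<subseteq> cell k x"
  by (auto simp: mem_cell_iff mem_box_cart less_imp_le)

lemma cbox_in_cubes: "cbox (corner k x) (corner k x + (\<chi> i. h / 2 ^ k)) \<in> cubes"
  using h_pos unfolding cubes_def by (auto intro!: exI[of _ "h / 2 ^ k"])

lemma abs_diff_cell_less:
  assumes "y \<in> cell k x"
  shows "\<bar>y $ i - x $ i\<bar> < h / 2 ^ k"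
proof -
  have "x \<in> cell k x" by simp
  with assms show ?thesis
    unfolding mem_cell_iff by (smt (verit))
qed

text \<open>Nesting of the levels: in each coordinate, the index of level \<open>j\<close> is the
  integer quotient of the index of level \<open>k\<close> by \<open>2 ^ (k - j)\<close>.\<close>

lemma index_mono:
  assumes "index k x = index k y" and "j \<le> k"
  shows "index j x = index j y"
proof -
  have "\<lfloor>2 ^ j * t\<rfloor> = \<lfloor>2 ^ k * t\<rfloor> div 2 ^ (k - j)" for t :: real
  proof -
    have "2 ^ j * t = 2 ^ k * t / real_of_int (2 ^ (k - j))"
      using power_add[of "2::real" j "k - j"] assms(2) by simp
    then have "\<lfloor>2 ^ j * t\<rfloor> = \<lfloor>2 ^ k * t / real_of_int (2 ^ (k - j))\<rfloor>"
      by (rule arg_cong)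
    also have "\<dots> = \<lfloor>2 ^ k * t\<rfloor> div 2 ^ (k - j)"
      by (rule floor_divide_real_eq_div) simp
    finally show ?thesis .
  qed
  then show ?thesis
    using assms(1) by (simp add: index_def vec_eq_iff del: times_divide_eq_right)
qed

lemma cell_antimono: "j \<le> k \<Longrightarrow> cell k x \<subseteq> cell j x"
  unfolding cell_def by (blast intro: index_mono)

lemma cell_eq_mono: "index k x = index k y \<Longrightarrow> j \<le> k \<Longrightarrow> cell j x = cell j y"
  unfolding cell_def by (simp add: index_mono[of k x y j])

text \<open>All points of \<open>cell k x\<close> have l1-distance at most
  \<open>CARD('n) * h / 2 ^ k\<close> from \<open>x\<close>, and this tends to
  \<open>0\<close>.\<close>

lemma cell_subset_open:
  assumes "open U" "x \<in> U"
  obtains k where "cell k x \<subseteq> U"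
proof -
  obtain e where e: "0 < e" "ball x e \<subseteq> U"
    using openE[OF assms] by metis
  have "(\<lambda>k. CARD('n) * h * (1 / 2) ^ k) \<longlonglongrightarrow> CARD('n) * h * 0"
    by (intro tendsto_intros LIMSEQ_power_zero) auto
  then have "\<forall>\<^sub>F k in sequentially. CARD('n) * h * (1 / 2) ^ k < e"
    using e(1) by (auto dest: order_tendstoD(2))
  then obtain k where k: "CARD('n) * h * (1 / 2) ^ k < e"
    by (meson eventually_happens sequentially_bot)
  have "y \<in> U" if "y \<in> cell k x" for y
  proof -
    have "norm (y - x) \<le> (\<Sum>i\<in>UNIV. \<bar>y $ i - x $ i\<bar>)"
      using norm_le_l1_cart[of "y - x"] by simp
    also have "\<dots> \<le> (\<Sum>i\<in>(UNIV :: 'n set). h / 2 ^ k)"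
      using abs_diff_cell_less[OF that] by (intro sum_mono less_imp_le)
    also have "\<dots> < e"
      using k by (simp add: field_simps)
    finally show ?thesis
      using e(2) by (auto simp: dist_norm norm_minus_commute)
  qed
  then show thesis using that by blast
qed

lemma cell_borel [measurable]: "cell k x \<in> sets borel"
proof -
  have "cell k x = (\<Inter>i. {y. corner k x $ i \<le> y $ i} \<inter> {y. y $ i < corner k x $ i + h / 2 ^ k})"
    by (auto simp: mem_cell_iff)
  also have "\<dots> \<in> sets borel"
    by measurable
  finally show ?thesis .
qed

lemma cell_lebesgue [measurable]: "cell k x \<in> sets lebesgue"
  using cell_borel by (simp add: sets_completionI_sets)

lemma AE_cbox_iff_cell:
  "AE y in lebesgue. y \<in> cbox (corner k x) (corner k x + (\<chi> i. h / 2 ^ k)) \<longleftrightarrow> y \<in> cell k x"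
proof -
  let ?u = "corner k x + (\<chi> i. h / 2 ^ k)"
  have "AE y in lebesgue. y \<notin> cbox (corner k x) ?u - box (corner k x) ?u"
    using negligible_frontier_interval[of "corner k x" ?u]
    by (intro AE_not_in) (simp add: negligible_iff_null_sets)
  then show ?thesis
  proof eventually_elim
    case (elim y)
    then show ?case
      using cell_subset_cbox[of k x] box_subset_cell[of k x] by blast
  qed
qed

lemma corner_0_self [simp]: "corner 0 a = a"
  by (simp add: corner_def index_def vec_eq_iff)

lemma emeasure_cell: "emeasure lebesgue (cell k x) = ennreal ((h / 2 ^ k) ^ CARD('n))"
proof -
  have "emeasure lebesgue (cbox (corner k x) (corner k x + (\<chi> i. h / 2 ^ k))) = emeasure lebesgue (cell k x)"
    by (rule emeasure_eq_AE[OF AE_cbox_iff_cell]) auto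
  then show ?thesis
    using h_pos emeasure_cube[of "h / 2 ^ k" "corner k x"] by (simp only:) simp
qed

lemma emeasure_cell_pos: "emeasure lebesgue (cell k x) \<noteq> 0"
  using h_pos by (simp add: emeasure_cell)

lemma emeasure_cell_finite: "emeasure lebesgue (cell k x) \<noteq> \<infinity>"
  by (simp add: emeasure_cell)

lemma emeasure_cell_Suc:
  "emeasure lebesgue (cell k x) = 2 ^ CARD('n) * emeasure lebesgue (cell (Suc k) x)"
proof -
  have "(h / 2 ^ k) ^ CARD('n) = 2 ^ CARD('n) * (h / 2 ^ Suc k) ^ CARD('n)"
    by (simp flip: power_mult_distrib)
  then show ?thesis
    using h_pos unfolding emeasure_cell
    by (simp add: ennreal_mult flip: ennreal_power)
qed

text \<open>Plays the role of measurability with respect to the sigma-algebra generated by the cells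
  of level \<open>k\<close>.\<close>

definition const_on_cells :: "nat \<Rightarrow> (real^'n \<Rightarrow> 'b) \<Rightarrow> bool" where
  "const_on_cells k \<phi> \<longleftrightarrow> (\<forall>x y. index k x = index k y \<longrightarrow> \<phi> x = \<phi> y)"

text \<open>Indices live in the countable type \<open>int^'n\<close>, so every preimage is a
  countable union of cells.\<close>

lemma measurable_const_on_cells:
  assumes "const_on_cells k \<phi>" and "\<And>x. \<phi> x \<in> space M"
  shows "\<phi> \<in> measurable lebesgue M"
proof (rule measurableI)
  fix A assume "A \<in> sets M"
  have "\<phi> -` A = (\<Union>c\<in>index k ` (\<phi> -` A). {x. index k x = c})"
  proof (intro equalityI subsetI)
    fix x assume "x \<in> (\<Union>c\<in>index k ` (\<phi> -` A). {x. index k x = c})"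
    then obtain y where "\<phi> y \<in> A" "index k x = index k y" by blast
    then show "x \<in> \<phi> -` A"
      using assms(1) unfolding const_on_cells_def by (metis vimageI2)
  qed blast
  also have "\<dots> \<in> sets lebesgue"
  proof (rule sets.countable_UN'')
    fix c assume "c \<in> index k ` (\<phi> -` A)"
    then obtain z where "c = index k z" by blast
    then show "{x. index k x = c} \<in> sets lebesgue"
      using cell_lebesgue[of k z] by (simp add: cell_def)
  qed simp
  finally show "\<phi> -` A \<inter> space lebesgue \<in> sets lebesgue" by simp
qed (use assms in auto)

lemma const_on_cells_avg: "j \<le> k \<Longrightarrow> const_on_cells k (\<lambda>x. avg (cell j x) g)"
  unfolding const_on_cells_def using cell_eq_mono by metis

lemma borel_measurable_avg_cell [measurable]: "(\<lambda>x. avg (cell k x) g) \<in> borel_measurable lebesgue"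
  by (rule measurable_const_on_cells[OF const_on_cells_avg[OF order_refl]]) simp

lemma avg_cell_times_emeasure:
  "avg (cell k x) g * emeasure lebesgue (cell k x) = (\<integral>\<^sup>+y\<in>cell k x. g y \<partial>lebesgue)"
  using emeasure_cell_pos[of k x] emeasure_cell_finite[of k x]
  by (simp add: avg_def ennreal_divide_times less_top)

text \<open>Averaging over the cells of level \<open>k\<close> is the conditional expectation onto the
  functions that are constant on those cells.\<close>

lemma nn_integral_const_on_cells:
  assumes \<phi>: "const_on_cells k \<phi>" and g[measurable]: "g \<in> borel_measurable lebesgue"
  shows "(\<integral>\<^sup>+x. \<phi> x * g x \<partial>lebesgue) = (\<integral>\<^sup>+x. \<phi> x * avg (cell k x) g \<partial>lebesgue)"
proof -
  have [measurable]: "\<phi> \<in> borel_measurable lebesgue"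
    using measurable_const_on_cells[OF \<phi>] by simp
  let ?I = "range (index k)"
  define D where "D c = {x. index k x = c}" for c
  have D_cell: "D (index k z) = cell k z" for z
    by (simp add: D_def cell_def)
  have D_sets [measurable]: "D c \<in> sets lebesgue" for c
  proof (cases "c \<in> ?I")
    case True
    then show ?thesis using D_cell by auto
  next
    case False
    then have "D c = {}" by (auto simp: D_def)
    then show ?thesis by simp
  qed
  \<comment> \<open>Decompose the integral over the cells. Exactly one index contributes at each
    \<open>x\<close>, and the sum over indices, written as an integral over
    \<open>count_space\<close>, may be exchanged with the integral.\<close>
  have split: "(\<integral>\<^sup>+x. f x \<partial>lebesgue) = (\<integral>\<^sup>+c. (\<integral>\<^sup>+x. f x * indicator (D c) x \<partial>lebesgue) \<partial>count_space ?I)"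
    if [measurable]: "f \<in> borel_measurable lebesgue" for f :: "real^'n \<Rightarrow> ennreal"
  proof -
    have "f x = (\<integral>\<^sup>+c. f x * indicator (D c) x \<partial>count_space ?I)" for x
    proof -
      have "(\<integral>\<^sup>+c. f x * indicator (D c) x \<partial>count_space ?I) = (\<integral>\<^sup>+c. f x * indicator {index k x} c \<partial>count_space ?I)"
        by (rule nn_integral_cong) (auto simp: D_def split: split_indicator)
      also have "\<dots> = f x"
        by (subst nn_integral_cmult_indicator) auto
      finally show ?thesis by simp
    qed
    then have "(\<integral>\<^sup>+x. f x \<partial>lebesgue) = (\<integral>\<^sup>+x. (\<integral>\<^sup>+c. f x * indicator (D c) x \<partial>count_space ?I) \<partial>lebesgue)"
      by simp
    also have "\<dots> = (\<integral>\<^sup>+c. (\<integral>\<^sup>+x. f x * indicator (D c) x \<partial>lebesgue) \<partial>count_space ?I)"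
      by (rule nn_integral_count_space_nn_integral) auto
    finally show ?thesis .
  qed
  have "(\<integral>\<^sup>+x. \<phi> x * g x * indicator (D c) x \<partial>lebesgue)
      = (\<integral>\<^sup>+x. \<phi> x * avg (cell k x) g * indicator (D c) x \<partial>lebesgue)" if c: "c \<in> ?I" for c
  proof -
    obtain z where z: "index k z = c" using c by blast
    then have Dz: "D c = cell k z"
      using D_cell by blast
    have eq: "\<phi> x = \<phi> z" "cell k x = cell k z" if "x \<in> D c" for x
      using \<phi> that z unfolding const_on_cells_def cell_def D_def by auto
    have "(\<integral>\<^sup>+x. \<phi> x * g x * indicator (D c) x \<partial>lebesgue) = (\<integral>\<^sup>+x. \<phi> z * (g x * indicator (D c) x) \<partial>lebesgue)"
      by (rule nn_integral_cong) (auto simp: eq split: split_indicator)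
    also have "\<dots> = \<phi> z * (avg (cell k z) g * emeasure lebesgue (cell k z))"
      unfolding avg_cell_times_emeasure Dz by (rule nn_integral_cmult) measurable
    also have "\<dots> = (\<integral>\<^sup>+x. \<phi> z * avg (cell k z) g * indicator (D c) x \<partial>lebesgue)"
      by (subst nn_integral_cmult_indicator) (auto simp: Dz mult.assoc)
    also have "\<dots> = (\<integral>\<^sup>+x. \<phi> x * avg (cell k x) g * indicator (D c) x \<partial>lebesgue)"
      by (rule nn_integral_cong) (auto simp: eq split: split_indicator)
    finally show ?thesis .
  qed
  then have "(\<integral>\<^sup>+c. (\<integral>\<^sup>+x. \<phi> x * g x * indicator (D c) x \<partial>lebesgue) \<partial>count_space ?I)
    = (\<integral>\<^sup>+c. (\<integral>\<^sup>+x. \<phi> x * avg (cell k x) g * indicator (D c) x \<partial>lebesgue) \<partial>count_space ?I)"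
    by (rule nn_integral_cong) simp
  then show ?thesis
    by (subst (1 2) split) simp_all
qed

text \<open>The closure of the cell is a cube of the same measure that contains \<open>x\<close>,
  hence it competes in the supremum defining \<open>maximal\<close>.\<close>

lemma avg_cell_le_maximal: "avg (cell k x) (\<lambda>y. ennreal \<bar>f y\<bar>) \<le> maximal f x"
proof -
  let ?P = "cbox (corner k x) (corner k x + (\<chi> i. h / 2 ^ k))"
  have "avg (cell k x) (\<lambda>y. ennreal \<bar>f y\<bar>) \<le> avg ?P (\<lambda>y. ennreal \<bar>f y\<bar>)"
    unfolding avg_def emeasure_cell using h_pos cell_subset_cbox[of k x]
    by (subst emeasure_cube)
       (auto intro!: divide_right_mono_ennreal nn_integral_mono mult_left_mono split: split_indicator)
  also have "\<dots> \<le> maximal f x"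
    unfolding maximal_def using cbox_in_cubes cell_subset_cbox[of k x] self_in_cell[of x k]
    by (intro SUP_upper) blast
  finally show ?thesis .
qed

text \<open>The parent cell contains the smaller one and has \<open>2 ^ CARD('n)\<close> times its
  measure. This is the source of the dimensional factor in the \<open>L log L\<close> bound.\<close>

lemma avg_cell_Suc_le: "avg (cell (Suc k) x) g \<le> 2 ^ CARD('n) * avg (cell k x) g"
proof -
  let ?m = "emeasure lebesgue (cell (Suc k) x)"
  have "avg (cell (Suc k) x) g * ?m \<le> avg (cell k x) g * emeasure lebesgue (cell k x)"
    unfolding avg_cell_times_emeasure using cell_antimono[of k "Suc k" x]
    by (intro nn_integral_mono mult_left_mono) (auto split: split_indicator)
  also have "\<dots> = (2 ^ CARD('n) * avg (cell k x) g) * ?m"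
    by (simp only: emeasure_cell_Suc[of k x] mult_ac)
  finally have "?m * avg (cell (Suc k) x) g \<le> ?m * (2 ^ CARD('n) * avg (cell k x) g)"
    by (simp only: mult.commute)
  moreover have "?m \<noteq> 0" "?m \<noteq> top"
    using emeasure_cell_pos[of "Suc k" x] emeasure_cell_finite[of "Suc k" x] by auto
  ultimately show ?thesis
    by (simp only: ennreal_mult_le_mult_iff not_False_eq_True)
qed

end

section \<open>Dyadic maximal function\<close>

text \<open>One step of the telescoping: \<open>m\<close> is the old maximal average,
  \<open>f\<close> the new average and \<open>c\<close> the doubling factor. If
  \<open>f > m\<close>, use \<open>ln (f / m) \<le> f / m - 1\<close> and
  \<open>f / m \<le> c\<close>; otherwise nothing changes. Writing it without differences lets it
  pass to \<open>ennreal\<close>.\<close>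

lemma log_increment_le:
  fixes f m c l :: real
  assumes "0 < l" "l \<le> m" "f \<le> c * m"
  shows "f * ln (max m f / l) + c * m \<le> f * ln (m / l) + c * max m f"
proof (cases "f \<le> m")
  case False
  then have "0 < m" "0 < f" using assms by linarith+
  then have "ln (f / l) - ln (m / l) \<le> f / m - 1"
    using assms ln_le_minus_one[of "f / m"] by (simp add: ln_div)
  then have "f * (ln (f / l) - ln (m / l)) \<le> f * (f / m - 1)"
    using \<open>0 < f\<close> by (intro mult_left_mono) auto
  also have "\<dots> = f / m * (f - m)"
    using \<open>0 < m\<close> by (simp add: field_simps)
  also have "\<dots> \<le> c * (f - m)"
    using assms(3) \<open>0 < m\<close> False by (intro mult_right_mono) (auto simp: divide_le_eq)
  finally show ?thesis
    using False by (simp add: max_def algebra_simps)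
qed (simp add: max_def)

text \<open>For \<open>f > m\<close> with \<open>f\<close> finite this is
  \<open>(f - m)\<^sup>2 \<ge> 0\<close>, and for \<open>f \<le> m\<close> both sides agree. It
  controls the growth of the squared running maximum.\<close>

lemma square_increment_le:
  fixes m f :: ennreal
  shows "(max m f)\<^sup>2 + 2 * (m * f) \<le> m\<^sup>2 + 2 * (max m f * f)"
proof (cases "f \<le> m")
  case False
  show ?thesis
  proof (cases "f = \<infinity>")
    case True
    then have "2 * (max m f * f) = top"
      by (simp add: ennreal_mult_eq_top_iff max_def)
    then show ?thesis by (simp only: add_top) simp
  next
    case fin: False
    then obtain s where s: "0 \<le> s" "f = ennreal s" by (cases f) auto
    moreover from False fin obtain r where r: "0 \<le> r" "m = ennreal r" by (cases m) auto
    moreover have "ennreal (s\<^sup>2 + 2 * (r * s)) \<le> ennreal (r\<^sup>2 + 2 * (s * s))"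
      using zero_le_power2[of "s - r"]
      by (intro ennreal_leI) (simp add: power2_eq_square algebra_simps)
    moreover have "max m f = f" using False by (auto simp: max_def)
    ultimately show ?thesis
      by (simp add: ennreal_mult flip: ennreal_power)
  qed
qed (simp add: max_def)

text \<open>Expands \<open>(x - 2 * y)\<^sup>2 \<ge> 0\<close>. The weights leave
  \<open>x\<^sup>2\<close> with coefficient one, so that it can be absorbed in
  \<open>doob_L2\<close>, and produce the constant \<open>4\<close> there.\<close>

lemma two_mult_le_squares:
  fixes x y :: ennreal
  shows "2 * (2 * (x * y)) \<le> x\<^sup>2 + 4 * y\<^sup>2"
proof (cases "x = \<infinity> \<or> y = \<infinity>")
  case True
  then have "x\<^sup>2 = top \<or> 4 * y\<^sup>2 = top"
    by (auto simp: ennreal_mult_eq_top_iff power_eq_top_ennreal)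
  then show ?thesis by auto
next
  case False
  then obtain r s where "0 \<le> r" "x = ennreal r" "0 \<le> s" "y = ennreal s"
    by (cases x; cases y) auto
  moreover have "ennreal (2 * (2 * (r * s))) \<le> ennreal (r\<^sup>2 + 4 * s\<^sup>2)"
    using zero_le_power2[of "r - 2 * s"]
    by (intro ennreal_leI) (simp add: power2_eq_square algebra_simps)
  ultimately show ?thesis
    by (simp add: ennreal_mult flip: ennreal_power)
qed

context dyadic_grid
begin

primrec max_avg :: "(real^'n \<Rightarrow> ennreal) \<Rightarrow> nat \<Rightarrow> real^'n \<Rightarrow> ennreal" where
  "max_avg g 0 x = avg (cell 0 x) g"
| "max_avg g (Suc k) x = max (max_avg g k x) (avg (cell (Suc k) x) g)"

text \<open>Levels start at \<open>0\<close>, so only cells of side at most \<open>h\<close>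
  compete.\<close>

definition dyadic_maximal :: "(real^'n \<Rightarrow> ennreal) \<Rightarrow> real^'n \<Rightarrow> ennreal" where
  "dyadic_maximal g x = (SUP k. avg (cell k x) g)"

lemma const_on_cells_max_avg:
  assumes "j \<le> k"
  shows "const_on_cells k (max_avg g j)"
  unfolding const_on_cells_def
proof (intro allI impI)
  fix x y assume eq: "index k x = index k y"
  show "max_avg g j x = max_avg g j y"
    using assms
  proof (induction j)
    case 0
    then show ?case using cell_eq_mono[OF eq, of 0] by simp
  next
    case (Suc j)
    then show ?case using cell_eq_mono[OF eq, of "Suc j"] by simp
  qed
qed

lemma borel_measurable_max_avg [measurable]: "max_avg g k \<in> borel_measurable lebesgue"
  by (rule measurable_const_on_cells[OF const_on_cells_max_avg[OF order_refl]]) simp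

lemma borel_measurable_dyadic_maximal [measurable]: "dyadic_maximal g \<in> borel_measurable lebesgue"
  unfolding dyadic_maximal_def by measurable

lemma avg_le_max_avg: "avg (cell k x) g \<le> max_avg g k x"
  by (cases k) auto

lemma max_avg_mono: "j \<le> k \<Longrightarrow> max_avg g j x \<le> max_avg g k x"
  by (rule lift_Suc_mono_le[of "\<lambda>k. max_avg g k x"]) auto

lemma max_avg_least: "(\<And>j. j \<le> k \<Longrightarrow> avg (cell j x) g \<le> B) \<Longrightarrow> max_avg g k x \<le> B"
  by (induction k) auto

lemma max_avg_le_dyadic_maximal: "max_avg g k x \<le> dyadic_maximal g x"
  unfolding dyadic_maximal_def by (intro max_avg_least SUP_upper) simp

lemma SUP_max_avg: "(SUP k. max_avg g k x) = dyadic_maximal g x"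
proof (rule antisym)
  show "(SUP k. max_avg g k x) \<le> dyadic_maximal g x"
    by (intro SUP_least max_avg_le_dyadic_maximal)
  show "dyadic_maximal g x \<le> (SUP k. max_avg g k x)"
    unfolding dyadic_maximal_def by (intro SUP_mono) (auto intro: avg_le_max_avg)
qed

lemma dyadic_maximal_le_maximal: "dyadic_maximal (\<lambda>y. ennreal \<bar>f y\<bar>) x \<le> maximal f x"
  unfolding dyadic_maximal_def by (intro SUP_least avg_cell_le_maximal)

section \<open>Doob's \<open>L\<^sup>2\<close> inequality for the dyadic maximal function\<close>

lemma avg_cell_le_integral:
  "avg (cell k x) g \<le> (\<integral>\<^sup>+y. g y \<partial>lebesgue) / ennreal ((h / 2 ^ k) ^ CARD('n))"
  unfolding avg_def emeasure_cell
  by (intro divide_right_mono_ennreal nn_integral_mono) (auto split: split_indicator)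

text \<open>Each of the finitely many levels has a bound uniform in \<open>x\<close>; their sum
  serves as \<open>B\<close>. This supplies the finiteness required for cancelling terms in
  \<open>ennreal\<close>.\<close>

lemma max_avg_bounded:
  assumes "(\<integral>\<^sup>+y. g y \<partial>lebesgue) < \<infinity>"
  obtains B where "B < \<infinity>" "\<And>x. max_avg g k x \<le> B"
proof
  let ?b = "\<lambda>j. (\<integral>\<^sup>+y. g y \<partial>lebesgue) / ennreal ((h / 2 ^ j) ^ CARD('n))"
  show "(\<Sum>j\<le>k. ?b j) < \<infinity>"
    using assms h_pos by (auto simp: ennreal_divide_eq_top_iff less_top[symmetric])
  show "max_avg g k x \<le> (\<Sum>j\<le>k. ?b j)" for x
  proof (rule max_avg_least)
    fix j assume "j \<le> k"
    then have "?b j \<le> (\<Sum>j\<le>k. ?b j)"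
      by (intro member_le_sum) auto
    with avg_cell_le_integral show "avg (cell j x) g \<le> (\<Sum>j\<le>k. ?b j)"
      by (rule order_trans)
  qed
qed

lemma nn_integral_max_avg_mult_finite:
  assumes [measurable]: "g \<in> borel_measurable lebesgue" and fin: "(\<integral>\<^sup>+y. g y \<partial>lebesgue) < \<infinity>"
  shows "(\<integral>\<^sup>+x. max_avg g k x * g x \<partial>lebesgue) < \<infinity>"
proof -
  obtain B where B: "B < \<infinity>" "\<And>x. max_avg g k x \<le> B"
    using max_avg_bounded[OF fin] by blast
  have "(\<integral>\<^sup>+x. max_avg g k x * g x \<partial>lebesgue) \<le> (\<integral>\<^sup>+x. B * g x \<partial>lebesgue)"
    by (intro nn_integral_mono mult_right_mono B) simp
  also have "\<dots> < \<infinity>"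
    using B(1) fin by (simp add: nn_integral_cmult ennreal_mult_less_top)
  finally show ?thesis .
qed

text \<open>Induction on the level. Both \<open>max_avg g k\<close> and
  \<open>max_avg g (Suc k)\<close> are constant on the cells of level \<open>Suc k\<close>, so
  \<open>g\<close> may be replaced by its average there, after which
  \<open>square_increment_le\<close> applies pointwise.\<close>

lemma doob_max_avg:
  assumes [measurable]: "g \<in> borel_measurable lebesgue" and fin: "(\<integral>\<^sup>+y. g y \<partial>lebesgue) < \<infinity>"
  shows "(\<integral>\<^sup>+x. (max_avg g k x)\<^sup>2 \<partial>lebesgue) \<le> 2 * (\<integral>\<^sup>+x. max_avg g k x * g x \<partial>lebesgue)"
proof (induction k)
  case 0
  have "(\<integral>\<^sup>+x. max_avg g 0 x * g x \<partial>lebesgue) = (\<integral>\<^sup>+x. (max_avg g 0 x)\<^sup>2 \<partial>lebesgue)"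
    by (subst nn_integral_const_on_cells[OF const_on_cells_max_avg[of 0 0]])
       (auto simp: power2_eq_square)
  then show ?case
    by (simp add: mult_2)
next
  case (Suc k)
  let ?f = "\<lambda>x. avg (cell (Suc k) x) g"
  let ?J = "\<lambda>k. \<integral>\<^sup>+x. max_avg g k x * g x \<partial>lebesgue"
  let ?S = "\<lambda>k. \<integral>\<^sup>+x. (max_avg g k x)\<^sup>2 \<partial>lebesgue"
  have J: "?J j = (\<integral>\<^sup>+x. max_avg g j x * ?f x \<partial>lebesgue)" if "j \<le> Suc k" for j
    by (rule nn_integral_const_on_cells[OF const_on_cells_max_avg[OF that]]) simp
  have "?S (Suc k) + 2 * ?J k
      = (\<integral>\<^sup>+x. (max_avg g (Suc k) x)\<^sup>2 + 2 * (max_avg g k x * ?f x) \<partial>lebesgue)"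
    by (simp add: J nn_integral_add nn_integral_cmult del: max_avg.simps)
  also have "\<dots> \<le> (\<integral>\<^sup>+x. (max_avg g k x)\<^sup>2 + 2 * (max_avg g (Suc k) x * ?f x) \<partial>lebesgue)"
    unfolding max_avg.simps by (intro nn_integral_mono square_increment_le)
  also have "\<dots> = ?S k + 2 * ?J (Suc k)"
    by (simp add: J nn_integral_add nn_integral_cmult del: max_avg.simps)
  also have "\<dots> \<le> 2 * ?J k + 2 * ?J (Suc k)"
    by (intro add_right_mono Suc.IH)
  finally have "2 * ?J k + ?S (Suc k) \<le> 2 * ?J k + 2 * ?J (Suc k)"
    by (simp only: add.commute)
  moreover have "2 * ?J k \<noteq> \<infinity>"
    using nn_integral_max_avg_mult_finite[OF assms, of k] by (simp add: ennreal_mult_eq_top_iff)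
  ultimately show ?case
    by (simp only: ennreal_add_left_cancel_le) simp
qed

text \<open>With \<open>S\<close> the integral of the squared \<open>max_avg\<close>, the previous
  bound and \<open>two_mult_le_squares\<close> give
  \<open>S + S \<le> S + 4 \<integral> g\<^sup>2\<close>. As \<open>S\<close> is finite it cancels,
  and monotone convergence in \<open>k\<close> finishes.\<close>

lemma doob_L2:
  assumes [measurable]: "g \<in> borel_measurable lebesgue" and fin: "(\<integral>\<^sup>+y. g y \<partial>lebesgue) < \<infinity>"
  shows "(\<integral>\<^sup>+x. (dyadic_maximal g x)\<^sup>2 \<partial>lebesgue) \<le> 4 * (\<integral>\<^sup>+x. (g x)\<^sup>2 \<partial>lebesgue)"
proof -
  have "(\<integral>\<^sup>+x. (max_avg g k x)\<^sup>2 \<partial>lebesgue) \<le> 4 * (\<integral>\<^sup>+x. (g x)\<^sup>2 \<partial>lebesgue)" for k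
  proof -
    let ?S = "\<integral>\<^sup>+x. (max_avg g k x)\<^sup>2 \<partial>lebesgue"
    let ?J = "\<integral>\<^sup>+x. max_avg g k x * g x \<partial>lebesgue"
    have "?S + ?S \<le> 2 * (2 * ?J)"
      using doob_max_avg[OF assms, of k] by (simp add: mult_2 add_mono)
    also have "\<dots> = (\<integral>\<^sup>+x. 2 * (2 * (max_avg g k x * g x)) \<partial>lebesgue)"
      by (simp add: nn_integral_cmult)
    also have "\<dots> \<le> (\<integral>\<^sup>+x. (max_avg g k x)\<^sup>2 + 4 * (g x)\<^sup>2 \<partial>lebesgue)"
      by (intro nn_integral_mono two_mult_le_squares)
    also have "\<dots> = ?S + 4 * (\<integral>\<^sup>+x. (g x)\<^sup>2 \<partial>lebesgue)"
      by (simp add: nn_integral_add nn_integral_cmult)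
    finally have "?S + ?S \<le> ?S + 4 * (\<integral>\<^sup>+x. (g x)\<^sup>2 \<partial>lebesgue)" .
    moreover have "?S \<noteq> \<infinity>"
      using doob_max_avg[OF assms, of k] nn_integral_max_avg_mult_finite[OF assms, of k]
      by (auto simp: top_unique ennreal_mult_eq_top_iff)
    ultimately show ?thesis
      by (simp only: ennreal_add_left_cancel_le) simp
  qed
  moreover have "(dyadic_maximal g x)\<^sup>2 = (SUP k. (max_avg g k x)\<^sup>2)" for x
  proof -
    \<comment> \<open>The square of the supremum is a double supremum over \<open>i\<close> and
      \<open>j\<close>; by monotonicity the diagonal term at \<open>max i j\<close>
      dominates.\<close>
    have "max_avg g i x * max_avg g j x \<le> (SUP k. (max_avg g k x)\<^sup>2)" for i j
      by (rule SUP_upper2[of "max i j"]) (auto simp: power2_eq_square intro!: mult_mono max_avg_mono)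
    then have "(dyadic_maximal g x)\<^sup>2 \<le> (SUP k. (max_avg g k x)\<^sup>2)"
      unfolding SUP_max_avg[symmetric] power2_eq_square SUP_mult_left_ennreal SUP_mult_right_ennreal
      by (intro SUP_least)
    then show ?thesis
      by (intro antisym SUP_least power_mono max_avg_le_dyadic_maximal) auto
  qed
  moreover have "incseq (\<lambda>k x. (max_avg g k x)\<^sup>2)"
    by (auto simp: incseq_def le_fun_def intro!: power_mono max_avg_mono)
  ultimately show ?thesis
    by (simp add: nn_integral_monotone_convergence_SUP SUP_least)
qed

end

section \<open>Dyadic differentiation and the $L \log L$ bound\<close>

context dyadic_grid
begin

text \<open>Each point of an open set lies in some dyadic cell contained in that set, so outer
  regularity yields the differentiation theorem without a covering lemma.\<close>

lemma null_set_dyadic_maximal_less: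
  fixes b c :: real
  assumes g[measurable]: "g \<in> borel_measurable lebesgue" and fin: "(\<integral>\<^sup>+y. g y \<partial>lebesgue) < \<infinity>"
    and bc: "0 \<le> b" "b < c"
  shows "emeasure lebesgue {x. ennreal c < g x \<and> dyadic_maximal g x \<le> ennreal b} = 0"
proof -
  define E where "E = {x. ennreal c < g x \<and> dyadic_maximal g x \<le> ennreal b}"
  have E_eq: "E = {x \<in> space lebesgue. ennreal c < g x \<and> dyadic_maximal g x \<le> ennreal b}"
    by (simp add: E_def)
  have E[measurable]: "E \<in> sets lebesgue"
    unfolding E_eq by measurable
  have "ennreal c * emeasure lebesgue E = (\<integral>\<^sup>+x. ennreal c * indicator E x \<partial>lebesgue)"
    by (simp add: nn_integral_cmult_indicator)
  also have "\<dots> \<le> (\<integral>\<^sup>+x. g x \<partial>lebesgue)"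
    by (intro nn_integral_mono) (auto simp: E_def split: split_indicator)
  finally have "ennreal c * emeasure lebesgue E < \<infinity>"
    using fin by (rule le_less_trans)
  then have E_fin: "emeasure lebesgue E < \<infinity>"
    using bc by (auto simp: ennreal_mult_less_top)
  \<comment> \<open>Here \<open>e\<close> is the excess measure of an open set around
    \<open>E\<close>. Letting \<open>e\<close> tend to \<open>0\<close> compares \<open>c\<close>
    and \<open>b\<close> times the finite measure of \<open>E\<close>, and \<open>b < c\<close>
    forces that measure to vanish.\<close>
  have main: "ennreal c * emeasure lebesgue E \<le> ennreal b * emeasure lebesgue E + ennreal b * ennreal e"
    if e: "0 < e" for e :: real
  proof -
    obtain U where U: "open U" "E \<subseteq> U" "U - E \<in> lmeasurable" "emeasure lebesgue (U - E) < ennreal e"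
      using sets_lebesgue_outer_open[OF E e] by metis
    then have U_sets[measurable]: "U \<in> sets lebesgue"
      by (simp add: borel_open sets_completionI_sets)
    \<comment> \<open>Every cell that makes up \<open>V k\<close> contains a point of
      \<open>E\<close>, where \<open>dyadic_maximal\<close> is at most \<open>b\<close>, so the
      average of \<open>g\<close> over that cell is at most \<open>b\<close>. On \<open>E\<close>
      itself \<open>g\<close> exceeds \<open>c\<close>.\<close>
    define V where "V k = {x. cell k x \<subseteq> U \<and> cell k x \<inter> E \<noteq> {}}" for k
    have V_const: "const_on_cells k (indicator (V k) :: _ \<Rightarrow> ennreal)" for k
      unfolding const_on_cells_def V_def cell_def by (auto simp: indicator_def)
    have V_sets[measurable]: "V k \<in> sets lebesgue" for k
      using measurable_const_on_cells[OF V_const, of k borel] by (simp add: borel_measurable_indicator_iff)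
    have V_bound: "ennreal c * emeasure lebesgue (E \<inter> V k) \<le> ennreal b * emeasure lebesgue U" for k
    proof -
      have "ennreal c * emeasure lebesgue (E \<inter> V k) = (\<integral>\<^sup>+x. ennreal c * indicator (E \<inter> V k) x \<partial>lebesgue)"
        by (simp add: nn_integral_cmult_indicator)
      also have "\<dots> \<le> (\<integral>\<^sup>+x. indicator (V k) x * g x \<partial>lebesgue)"
        by (intro nn_integral_mono) (auto simp: E_def split: split_indicator)
      also have "\<dots> = (\<integral>\<^sup>+x. indicator (V k) x * avg (cell k x) g \<partial>lebesgue)"
        by (rule nn_integral_const_on_cells[OF V_const g])
      also have "\<dots> \<le> (\<integral>\<^sup>+x. ennreal b * indicator U x \<partial>lebesgue)"
      proof (rule nn_integral_mono)
        fix x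
        show "indicator (V k) x * avg (cell k x) g \<le> ennreal b * indicator U x"
        proof (cases "x \<in> V k")
          case True
          then obtain z where z: "z \<in> cell k x" "z \<in> E" "cell k x \<subseteq> U"
            unfolding V_def by blast
          then have "avg (cell k x) g \<le> dyadic_maximal g z"
            unfolding dyadic_maximal_def cell_eq[OF z(1), symmetric] by (intro SUP_upper) simp
          also have "\<dots> \<le> ennreal b"
            using z(2) by (simp add: E_def)
          finally have "avg (cell k x) g \<le> ennreal b" .
          moreover have "x \<in> U"
            using z(3) self_in_cell[of x k] by blast
          ultimately show ?thesis
            using True by simp
        qed simp
      qed
      also have "\<dots> = ennreal b * emeasure lebesgue U"
        by (simp add: nn_integral_cmult_indicator)
      finally show ?thesis .
    qed
    have "incseq (\<lambda>k. E \<inter> V k)"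
      unfolding incseq_def V_def using cell_antimono self_in_cell by blast
    then have "(SUP k. emeasure lebesgue (E \<inter> V k)) = emeasure lebesgue (\<Union>k. E \<inter> V k)"
      by (intro SUP_emeasure_incseq) auto
    also have "(\<Union>k. E \<inter> V k) = E"
    proof (intro equalityI subsetI)
      fix x assume "x \<in> E"
      moreover obtain k where "cell k x \<subseteq> U"
        using cell_subset_open[OF U(1)] U(2) \<open>x \<in> E\<close> by blast
      ultimately show "x \<in> (\<Union>k. E \<inter> V k)"
        unfolding V_def using self_in_cell[of x k] by blast
    qed blast
    finally have E_SUP: "(SUP k. emeasure lebesgue (E \<inter> V k)) = emeasure lebesgue E" .
    have "ennreal c * emeasure lebesgue E \<le> ennreal b * emeasure lebesgue U"
      unfolding E_SUP[symmetric] SUP_mult_left_ennreal by (intro SUP_least V_bound)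
    also have "emeasure lebesgue U \<le> emeasure lebesgue E + emeasure lebesgue (U - E)"
      using U(2) emeasure_subadditive[of E lebesgue "U - E"] U_sets E by (simp add: Un_absorb1)
    also have "\<dots> \<le> emeasure lebesgue E + ennreal e"
      using U(4) by (intro add_left_mono less_imp_le)
    finally show ?thesis
      by (simp add: distrib_left mult_left_mono)
  qed
  obtain m where m: "0 \<le> m" "emeasure lebesgue E = ennreal m"
    using E_fin by (cases "emeasure lebesgue E") auto
  have bound: "c * m \<le> b * m + b * e" if "0 < e" for e
    using main[OF that] bc m that by (simp flip: ennreal_mult ennreal_plus)
  have "c * m \<le> b * m + d" if "0 < d" for d
  \<comment> \<open>The choice \<open>e = d / b\<close> requires \<open>b \<noteq> 0\<close>; for
    \<open>b = 0\<close> the error term vanishes for every \<open>e\<close>.\<close>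
  proof (cases "b = 0")
    case False
    then show ?thesis using bound[of "d / b"] bc that by simp
  qed (use bound[of 1] that in simp)
  then have "c * m \<le> b * m"
    by (rule field_le_epsilon)
  then have "m \<le> 0"
    using bc by (simp add: mult_le_cancel_right)
  then show ?thesis
    using m by (simp add: E_def)
qed

text \<open>If \<open>dyadic_maximal g x < g x\<close>, two rationals \<open>b < c\<close> fit
  strictly between, which puts \<open>x\<close> into one of countably many null sets.\<close>

lemma AE_le_dyadic_maximal:
  assumes g[measurable]: "g \<in> borel_measurable lebesgue" and fin: "(\<integral>\<^sup>+y. g y \<partial>lebesgue) < \<infinity>"
  shows "AE x in lebesgue. g x \<le> dyadic_maximal g x"
proof -
  let ?E = "\<lambda>b c. {x. ennreal (real_of_rat c) < g x \<and> dyadic_maximal g x \<le> ennreal (real_of_rat b)}"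
  have "AE x in lebesgue. \<forall>b c. 0 \<le> b \<longrightarrow> b < c \<longrightarrow> x \<notin> ?E b c"
    unfolding AE_all_countable
  proof (intro allI AE_impI)
    fix b c :: rat assume bc: "0 \<le> b" "b < c"
    have "?E b c \<in> null_sets lebesgue"
    proof (intro null_setsI null_set_dyadic_maximal_less assms)
      have "{x \<in> space lebesgue. ennreal (real_of_rat c) < g x \<and> dyadic_maximal g x \<le> ennreal (real_of_rat b)} \<in> sets lebesgue"
        by measurable
      then show "?E b c \<in> sets lebesgue" by simp
    qed (use bc in \<open>auto simp: of_rat_less\<close>)
    then show "AE x in lebesgue. x \<notin> ?E b c"
      by (rule AE_not_in)
  qed
  then show ?thesis
  proof eventually_elim
    case (elim x)
    show ?case
    proof (rule ccontr)
      assume "\<not> g x \<le> dyadic_maximal g x"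
      then have less: "dyadic_maximal g x < g x" by simp
      obtain b where b: "dyadic_maximal g x < ennreal (real_of_rat b)" "ennreal (real_of_rat b) < g x"
        using ennreal_rat_dense[OF less] by blast
      obtain c where c: "ennreal (real_of_rat b) < ennreal (real_of_rat c)" "ennreal (real_of_rat c) < g x"
        using ennreal_rat_dense[OF b(2)] by blast
      have "0 < ennreal (real_of_rat b)"
        using b(1) by (rule le_less_trans[rotated]) simp
      then have "0 \<le> b" "b < c"
        using c(1) by (auto simp: ennreal_less_iff of_rat_less)
      then have "x \<notin> ?E b c"
        using elim by blast
      then show False
        using b(1) c(2) by (simp add: less_imp_le)
    qed
  qed
qed

text \<open>Telescopes \<open>log_increment_le\<close> over the levels. At level \<open>0\<close>
  the maximal average equals \<open>l\<close> throughout the cell, so the logarithm vanishes and the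
  two remaining terms agree.\<close>

lemma max_avg_LlogL:
  assumes g[measurable]: "g \<in> borel_measurable lebesgue" and fin: "(\<integral>\<^sup>+y. g y \<partial>lebesgue) < \<infinity>"
    and l: "avg (cell 0 z) g = ennreal l" "0 < l"
  shows "(\<integral>\<^sup>+x\<in>cell 0 z. ennreal (ln (enn2real (max_avg g k x) / l)) * g x \<partial>lebesgue)
      + 2 ^ CARD('n) * (\<integral>\<^sup>+x\<in>cell 0 z. g x \<partial>lebesgue)
    \<le> 2 ^ CARD('n) * (\<integral>\<^sup>+x\<in>cell 0 z. max_avg g k x \<partial>lebesgue)"
proof (induction k)
  have l_eq: "avg (cell 0 x) g = ennreal l" if "x \<in> cell 0 z" for x
    using cell_eq[OF that] l by simp
  let ?c = "2 ^ CARD('n) :: ennreal"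
  let ?i = "indicator (cell 0 z) :: _ \<Rightarrow> ennreal"
  let ?\<phi> = "\<lambda>k x. ennreal (ln (enn2real (max_avg g k x) / l)) * ?i x"
  let ?L = "\<lambda>k. \<integral>\<^sup>+x. ?\<phi> k x * g x \<partial>lebesgue"
  let ?M = "\<lambda>k. \<integral>\<^sup>+x\<in>cell 0 z. max_avg g k x \<partial>lebesgue"
  let ?G = "\<integral>\<^sup>+x\<in>cell 0 z. g x \<partial>lebesgue"
  have swap: "(\<integral>\<^sup>+x\<in>cell 0 z. ennreal (ln (enn2real (max_avg g k x) / l)) * g x \<partial>lebesgue) = ?L k" for k
    by (simp add: mult_ac)
  {
    case 0
    have "?L 0 = 0"
      using l by (subst nn_integral_0_iff_AE) (auto simp: l_eq split: split_indicator)
    moreover have "?G = ?M 0"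
    proof -
      have "?G = ennreal l * emeasure lebesgue (cell 0 z)"
        using avg_cell_times_emeasure[of 0 z g] l by simp
      also have "\<dots> = (\<integral>\<^sup>+x. ennreal l * ?i x \<partial>lebesgue)"
        by (simp add: nn_integral_cmult_indicator)
      also have "\<dots> = ?M 0"
        by (intro nn_integral_cong) (auto simp: l_eq split: split_indicator)
      finally show ?thesis .
    qed
    ultimately show ?case
      unfolding swap by simp
  next
    case (Suc k)
    let ?f = "\<lambda>x. avg (cell (Suc k) x) g"
    \<comment> \<open>The maxima of levels \<open>k\<close> and \<open>Suc k\<close> must be
      integrated against the same average \<open>?f\<close>; only then can their logarithms be
      compared pointwise.\<close>
    have L: "?L j = (\<integral>\<^sup>+x. ?\<phi> j x * ?f x \<partial>lebesgue)" if "j \<le> Suc k" for j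
    proof (rule nn_integral_const_on_cells[OF _ g])
      have "index 0 x = index 0 y" if "index (Suc k) x = index (Suc k) y" for x y
        using index_mono[OF that, of 0] by simp
      then show "const_on_cells (Suc k) (?\<phi> j)"
        using const_on_cells_max_avg[OF that, of g]
        unfolding const_on_cells_def cell_def indicator_def mem_Collect_eq by metis
    qed
    have pointwise: "?\<phi> (Suc k) x * ?f x + ?c * (max_avg g k x * ?i x)
        \<le> ?\<phi> k x * ?f x + ?c * (max_avg g (Suc k) x * ?i x)" for x
    proof (cases "x \<in> cell 0 z")
      case True
      obtain B where "B < \<infinity>" "max_avg g (Suc k) x \<le> B"
        using max_avg_bounded[OF fin, of "Suc k"] by blast
      then have "max_avg g (Suc k) x < \<infinity>"
        by (rule le_less_trans[rotated])
      then obtain m f where m: "0 \<le> m" "max_avg g k x = ennreal m" and f: "0 \<le> f" "?f x = ennreal f"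
        by (cases "max_avg g k x"; cases "?f x") auto
      have "ennreal l \<le> max_avg g k x"
        using max_avg_mono[of 0 k g x] l_eq[OF True] by simp
      with m have lm: "l \<le> m" by simp
      have "?f x \<le> ?c * max_avg g k x"
        by (rule order_trans[OF avg_cell_Suc_le]) (intro mult_left_mono avg_le_max_avg, simp)
      then have "ennreal f \<le> ennreal (2 ^ CARD('n) * m)"
        using m f by (simp add: ennreal_mult flip: ennreal_power)
      then have "f \<le> 2 ^ CARD('n) * m"
        using m by simp
      from log_increment_le[OF l(2) lm this]
      have "ennreal (ln (max m f / l) * f + 2 ^ CARD('n) * m)
          \<le> ennreal (ln (m / l) * f + 2 ^ CARD('n) * max m f)"
        by (intro ennreal_leI) (simp add: mult.commute)
      moreover have "0 \<le> ln (max m f / l)" "0 \<le> ln (m / l)"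
        using lm l(2) by (auto intro!: ln_ge_zero simp: le_divide_eq)
      ultimately have "ennreal (ln (max m f / l)) * ennreal f + ?c * ennreal m
          \<le> ennreal (ln (m / l)) * ennreal f + ?c * ennreal (max m f)"
        using m(1) f(1) by (simp add: ennreal_mult flip: ennreal_power)
      moreover have "max_avg g (Suc k) x = ennreal (max m f)"
        using m f by (simp add: max_def)
      ultimately show ?thesis
        using True m f by (simp del: max_avg.simps)
    qed simp
    have "?L (Suc k) + ?c * ?M k = (\<integral>\<^sup>+x. ?\<phi> (Suc k) x * ?f x + ?c * (max_avg g k x * ?i x) \<partial>lebesgue)"
      by (simp add: L nn_integral_add nn_integral_cmult del: max_avg.simps)
    also have "\<dots> \<le> (\<integral>\<^sup>+x. ?\<phi> k x * ?f x + ?c * (max_avg g (Suc k) x * ?i x) \<partial>lebesgue)"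
      by (intro nn_integral_mono pointwise)
    also have "\<dots> = ?L k + ?c * ?M (Suc k)"
      by (simp add: L nn_integral_add nn_integral_cmult del: max_avg.simps)
    finally have step: "?L (Suc k) + ?c * ?M k \<le> ?L k + ?c * ?M (Suc k)" .
    have "?c * ?M k + (?L (Suc k) + ?c * ?G) = (?L (Suc k) + ?c * ?M k) + ?c * ?G"
      by (simp only: add_ac)
    also have "\<dots> \<le> (?L k + ?c * ?M (Suc k)) + ?c * ?G"
      by (intro add_right_mono step)
    also have "\<dots> = (?L k + ?c * ?G) + ?c * ?M (Suc k)"
      by (simp only: add_ac)
    also have "\<dots> \<le> ?c * ?M k + ?c * ?M (Suc k)"
      using Suc.IH unfolding swap by (rule add_right_mono)
    finally have "?c * ?M k + (?L (Suc k) + ?c * ?G) \<le> ?c * ?M k + ?c * ?M (Suc k)" .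
    moreover have "?M k < \<infinity>"
    proof -
      obtain B where B: "B < \<infinity>" "\<And>x. max_avg g k x \<le> B"
        using max_avg_bounded[OF fin] by blast
      have "?M k \<le> (\<integral>\<^sup>+x. B * ?i x \<partial>lebesgue)"
        by (intro nn_integral_mono mult_right_mono B) simp
      also have "\<dots> = B * emeasure lebesgue (cell 0 z)"
        by (rule nn_integral_cmult_indicator) simp
      also have "\<dots> < \<infinity>"
        using B(1) emeasure_cell_finite[of 0 z] by (simp add: ennreal_mult_less_top less_top)
      finally show ?thesis .
    qed
    then have "?c * ?M k \<noteq> \<infinity>"
      by (simp add: ennreal_mult_eq_top_iff power_eq_top_ennreal)
    ultimately show ?case
      unfolding swap by (simp only: ennreal_add_left_cancel_le) simp
  }
qed

text \<open>The limit of \<open>max_avg_LlogL\<close>: almost everywhere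
  \<open>\<bar>f\<bar>\<close> is at most the supremum of the \<open>max_avg\<close>, which in turn
  is at most \<open>maximal f\<close>. Since \<open>ennreal\<close> sends negative numbers to
  \<open>0\<close>, the first integrand involves only the positive part of the logarithm.\<close>

lemma maximal_LlogL:
  assumes f[measurable]: "f \<in> borel_measurable lebesgue" and fin: "(\<integral>\<^sup>+y. ennreal \<bar>f y\<bar> \<partial>lebesgue) < \<infinity>"
    and l: "avg (cell 0 z) (\<lambda>y. ennreal \<bar>f y\<bar>) = ennreal l" "0 < l"
  shows "(\<integral>\<^sup>+x\<in>cell 0 z. ennreal (ln (\<bar>f x\<bar> / l)) * ennreal \<bar>f x\<bar> \<partial>lebesgue)
      + 2 ^ CARD('n) * (\<integral>\<^sup>+x\<in>cell 0 z. ennreal \<bar>f x\<bar> \<partial>lebesgue)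
    \<le> 2 ^ CARD('n) * (\<integral>\<^sup>+x\<in>cell 0 z. maximal f x \<partial>lebesgue)"
proof -
  let ?c = "2 ^ CARD('n) :: ennreal"
  let ?i = "indicator (cell 0 z) :: _ \<Rightarrow> ennreal"
  define g where "g = (\<lambda>y. ennreal \<bar>f y\<bar>)"
  have g[measurable]: "g \<in> borel_measurable lebesgue" by (simp add: g_def)
  have g_fin: "(\<integral>\<^sup>+y. g y \<partial>lebesgue) < \<infinity>" using fin by (simp add: g_def)
  let ?u = "\<lambda>k x. ennreal (ln (enn2real (max_avg g k x) / l)) * g x * ?i x"
  let ?G = "\<integral>\<^sup>+x\<in>cell 0 z. g x \<partial>lebesgue"
  let ?M = "\<integral>\<^sup>+x\<in>cell 0 z. maximal f x \<partial>lebesgue"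
  have max_avg_fin: "max_avg g k x < top" for k x
    using max_avg_bounded[OF g_fin, of k] by (metis infinity_ennreal_def le_less_trans)
  have max_avg_pos: "l \<le> enn2real (max_avg g k x)" if "x \<in> cell 0 z" for k x
  proof -
    have "ennreal l \<le> max_avg g k x"
      using max_avg_mono[of 0 k g x] cell_eq[OF that] l by (simp add: g_def)
    then have "enn2real (ennreal l) \<le> enn2real (max_avg g k x)"
      using max_avg_fin by (intro enn2real_mono) auto
    then show ?thesis
      using l by simp
  qed
  have "AE x in lebesgue. ennreal (ln (\<bar>f x\<bar> / l)) * g x * ?i x \<le> (SUP k. ?u k x)"
    using AE_le_dyadic_maximal[OF g g_fin]
  proof eventually_elim
    case (elim x)
    show ?case
    proof (cases "x \<in> cell 0 z")
      case True
      let ?s = "SUP k. ennreal (ln (enn2real (max_avg g k x) / l))"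
      \<comment> \<open>Only a finite supremum \<open>b\<close> needs an argument: every
        \<open>max_avg\<close> is then at most \<open>l * exp b\<close>, hence so are
        \<open>dyadic_maximal\<close> and \<open>\<bar>f x\<bar>\<close>.\<close>
      have "ennreal (ln (\<bar>f x\<bar> / l)) \<le> ?s"
      proof (cases ?s)
        case (real b)
        have "max_avg g k x \<le> ennreal (l * exp b)" for k
        proof -
          have "ennreal (ln (enn2real (max_avg g k x) / l)) \<le> ennreal b"
            unfolding real(2)[symmetric] by (rule SUP_upper) simp
          then have "ln (enn2real (max_avg g k x) / l) \<le> b"
            using real(1) by (simp add: ennreal_le_iff)
          moreover have "0 < enn2real (max_avg g k x) / l"
            using max_avg_pos[OF True, of k] l by simp
          ultimately have "enn2real (max_avg g k x) / l \<le> exp b"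
            by (metis exp_le_cancel_iff exp_ln)
          then have "enn2real (max_avg g k x) \<le> l * exp b"
            using l by (simp add: divide_le_eq mult.commute)
          then show ?thesis
            using max_avg_fin by (metis ennreal_enn2real ennreal_leI)
        qed
        then have "dyadic_maximal g x \<le> ennreal (l * exp b)"
          unfolding SUP_max_avg[symmetric] by (intro SUP_least)
        with elim have "ennreal \<bar>f x\<bar> \<le> ennreal (l * exp b)"
          unfolding g_def by (rule order_trans)
        then have fx: "\<bar>f x\<bar> / l \<le> exp b"
          using l by (simp add: ennreal_le_iff divide_le_eq mult.commute)
        have "ln (\<bar>f x\<bar> / l) \<le> b"
        \<comment> \<open>At a zero of \<open>f\<close> the convention \<open>ln 0 = 0\<close> gives
          the bound.\<close>
        proof (cases "f x = 0")
          case False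
          then have "0 < \<bar>f x\<bar> / l" using l by simp
          then show ?thesis using fx by (metis exp_le_cancel_iff exp_ln)
        qed (use real in simp)
        then show ?thesis
          unfolding real(2) by (rule ennreal_leI)
      next
        case top
        show ?thesis unfolding top by simp
      qed
      then have "ennreal (ln (\<bar>f x\<bar> / l)) * (g x * ?i x) \<le> ?s * (g x * ?i x)"
        by (rule mult_right_mono) simp
      then show ?thesis
        unfolding SUP_mult_right_ennreal by (simp only: mult.assoc)
    qed simp
  qed
  then have "(\<integral>\<^sup>+x. ennreal (ln (\<bar>f x\<bar> / l)) * g x * ?i x \<partial>lebesgue) \<le> (\<integral>\<^sup>+x. (SUP k. ?u k x) \<partial>lebesgue)"
    by (rule nn_integral_mono_AE)
  also have "\<dots> = (SUP k. \<integral>\<^sup>+x. ?u k x \<partial>lebesgue)"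
  proof (rule nn_integral_monotone_convergence_SUP)
    show "incseq ?u"
    proof (rule incseq_SucI, rule le_funI)
      fix k x
      show "?u k x \<le> ?u (Suc k) x"
      proof (cases "x \<in> cell 0 z")
        case True
        have "enn2real (max_avg g k x) \<le> enn2real (max_avg g (Suc k) x)"
          by (intro enn2real_mono max_avg_mono max_avg_fin) simp
        moreover have "0 < enn2real (max_avg g k x)"
          using max_avg_pos[OF True, of k] l by simp
        ultimately show ?thesis
          using l by (intro mult_right_mono ennreal_leI) (auto simp: divide_right_mono simp del: max_avg.simps)
      qed simp
    qed
  qed measurable
  finally have "(\<integral>\<^sup>+x. ennreal (ln (\<bar>f x\<bar> / l)) * g x * ?i x \<partial>lebesgue) + ?c * ?G
      \<le> (SUP k. \<integral>\<^sup>+x. ?u k x \<partial>lebesgue) + ?c * ?G"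
    by (rule add_right_mono)
  also have "\<dots> = (SUP k. (\<integral>\<^sup>+x. ?u k x \<partial>lebesgue) + ?c * ?G)"
    by (rule ennreal_SUP_add_left[symmetric]) simp
  also have "\<dots> \<le> ?c * ?M"
  proof (rule SUP_least)
    fix k
    have "(\<integral>\<^sup>+x. ?u k x \<partial>lebesgue) + ?c * ?G \<le> ?c * (\<integral>\<^sup>+x\<in>cell 0 z. max_avg g k x \<partial>lebesgue)"
      by (rule max_avg_LlogL[OF g g_fin _ l(2)]) (simp add: g_def l)
    also have "\<dots> \<le> ?c * ?M"
    proof (intro mult_left_mono nn_integral_mono mult_right_mono)
      fix x
      show "max_avg g k x \<le> maximal f x"
        using max_avg_le_dyadic_maximal dyadic_maximal_le_maximal[of f x] unfolding g_def
        by (rule order_trans)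
    qed auto
    finally show "(\<integral>\<^sup>+x. ?u k x \<partial>lebesgue) + ?c * ?G \<le> ?c * ?M" .
  qed
  finally show ?thesis
    by (simp only: g_def)
qed

end

section \<open>Weights\<close>

text \<open>Integrability on compact sets makes the cutoffs of \<open>w\<close> to balls measurable,
  and these converge pointwise to \<open>w\<close>.\<close>

lemma borel_measurable_weight:
  fixes w :: "real^'n \<Rightarrow> real"
  assumes "is_weight w"
  shows "w \<in> borel_measurable lebesgue"
proof (rule borel_measurable_LIMSEQ_real)
  fix m :: nat
  have "set_integrable lebesgue (cball (0::real^'n) (real m)) w"
    using assms unfolding is_weight_def loc_integrable_def by simp
  then show "(\<lambda>x. indicator (cball (0::real^'n) (real m)) x * w x) \<in> borel_measurable lebesgue"
    unfolding set_integrable_def by (simp add: borel_measurable_integrable)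
next
  fix x :: "real^'n"
  obtain m0 where "norm x \<le> real m0"
    using real_arch_simple by blast
  then have "indicator (cball (0::real^'n) (real m)) x * w x = w x" if "m0 \<le> m" for m
    using that by simp
  then have "\<forall>\<^sub>F m in sequentially. indicator (cball (0::real^'n) (real m)) x * w x = w x"
    by (rule eventually_sequentiallyI)
  then show "(\<lambda>m. indicator (cball (0::real^'n) (real m)) x * w x) \<longlonglongrightarrow> w x"
    by (rule tendsto_eventually)
qed

lemma AE_weight_pos: "is_weight w \<Longrightarrow> AE x in lebesgue. 0 < w x"
  by (simp add: is_weight_def)

lemma cubes_lebesgue: "Q \<in> cubes \<Longrightarrow> Q \<in> sets lebesgue"
  by (auto simp: cubes_def)

lemma emeasure_cubes:
  fixes Q :: "(real^'n) set"
  assumes "Q \<in> cubes"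
  shows "0 < emeasure lebesgue Q" "emeasure lebesgue Q < \<infinity>"
proof -
  obtain a h where Q: "Q = cbox a (a + (\<chi> i. h))" "0 < h"
    using assms unfolding cubes_def by blast
  then have "emeasure lebesgue Q = ennreal (h ^ CARD('n))"
    by (simp only: emeasure_cube less_imp_le)
  then show "0 < emeasure lebesgue Q" "emeasure lebesgue Q < \<infinity>"
    using Q(2) by auto
qed

lemma nn_integral_pos_if_AE_pos:
  assumes [measurable]: "g \<in> borel_measurable M" "R \<in> sets M"
    and "AE x in M. 0 < (g x :: ennreal)" and "0 < emeasure M R"
  shows "0 < (\<integral>\<^sup>+x\<in>R. g x \<partial>M)"
proof (rule ccontr)
  assume "\<not> ?thesis"
  then have "AE x in M. g x * indicator R x = 0"
    by (subst (asm) not_gr_zero, subst (asm) nn_integral_0_iff_AE) auto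
  with assms(3) have "AE x in M. x \<notin> R"
    by eventually_elim (auto split: split_indicator_asm)
  then have "R \<in> null_sets M"
    by (simp add: AE_iff_null_sets)
  with assms(4) show False
    by (auto simp: null_sets_def)
qed

lemma nn_integral_weight_cube:
  assumes w: "is_weight w" and Q: "Q \<in> cubes"
  shows "0 < (\<integral>\<^sup>+x\<in>Q. ennreal (w x) \<partial>lebesgue)" "(\<integral>\<^sup>+x\<in>Q. ennreal (w x) \<partial>lebesgue) < \<infinity>"
proof -
  have [measurable]: "w \<in> borel_measurable lebesgue"
    using borel_measurable_weight[OF w] .
  show "0 < (\<integral>\<^sup>+x\<in>Q. ennreal (w x) \<partial>lebesgue)"
    using AE_weight_pos[OF w] emeasure_cubes(1)[OF Q] cubes_lebesgue[OF Q]
    by (intro nn_integral_pos_if_AE_pos) auto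
  have "compact Q"
    using Q by (auto simp: cubes_def)
  then have "integrable lebesgue (\<lambda>x. indicator Q x *\<^sub>R w x)"
    using w unfolding is_weight_def loc_integrable_def set_integrable_def by blast
  then have "(\<integral>\<^sup>+x. ennreal (norm (indicator Q x *\<^sub>R w x)) \<partial>lebesgue) < \<infinity>"
    unfolding integrable_iff_bounded by blast
  moreover have "(\<integral>\<^sup>+x\<in>Q. ennreal (w x) \<partial>lebesgue) \<le> (\<integral>\<^sup>+x. ennreal (norm (indicator Q x *\<^sub>R w x)) \<partial>lebesgue)"
    by (intro nn_integral_mono) (auto split: split_indicator intro!: ennreal_leI)
  ultimately show "(\<integral>\<^sup>+x\<in>Q. ennreal (w x) \<partial>lebesgue) < \<infinity>"
    by (rule le_less_trans[rotated])
qed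

lemma emeasure_wmeasure_cube:
  assumes w: "is_weight w" and Q: "Q \<in> cubes"
  shows "emeasure (wmeasure w) Q = (\<integral>\<^sup>+x\<in>Q. ennreal (w x) \<partial>lebesgue)"
  unfolding wmeasure_def using borel_measurable_weight[OF w] cubes_lebesgue[OF Q]
  by (intro emeasure_density) simp_all

text \<open>Integrate \<open>ln t \<le> t - 1\<close> for \<open>t = w powr (- 1 / r) / s\<close> and for \<open>t = sqrt w / b\<close>.\<close>

lemma powr_avg_mult_avg_sqrt_ge_1:
  fixes w :: "'a \<Rightarrow> real" and r s b m :: real
  assumes [measurable]: "w \<in> borel_measurable M" "R \<in> sets M" and pos: "AE x in M. 0 < w x"
    and pos': "0 < r" "0 < s" "0 < b" "0 < m" and R: "emeasure M R = ennreal m"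
    and s: "(\<integral>\<^sup>+x\<in>R. ennreal (w x powr (- 1 / r)) \<partial>M) = ennreal (s * m)"
    and b: "(\<integral>\<^sup>+x\<in>R. ennreal (sqrt (w x)) \<partial>M) = ennreal (b * m)"
  shows "1 \<le> s powr r * b\<^sup>2"
proof -
  \<comment> \<open>\<open>exp K\<close> is the right-hand side of the claim. Adding
    \<open>r\<close> times the first logarithmic inequality to twice the second cancels
    \<open>ln (w x)\<close>.\<close>
  define K where "K = r * ln s + 2 * ln b"
  have "0 \<le> K"
  proof (rule ccontr)
    \<comment> \<open>For negative \<open>K\<close> the constant \<open>r + 2 - K\<close> is
      positive, so \<open>ennreal\<close> does not truncate it. Integrated over \<open>R\<close>,
      the right-hand side becomes \<open>(r + 2) * m\<close>, which contradicts
      \<open>K < 0\<close>.\<close>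
    assume K: "\<not> 0 \<le> K"
    have "AE x in M. ennreal (r + 2 - K) * indicator R x
        \<le> ennreal (r / s) * (ennreal (w x powr (- 1 / r)) * indicator R x)
          + ennreal (2 / b) * (ennreal (sqrt (w x)) * indicator R x)"
      using pos
    proof eventually_elim
      case (elim x)
      have "ln (w x powr (- 1 / r) / s) \<le> w x powr (- 1 / r) / s - 1"
        using elim pos' by (intro ln_le_minus_one) simp
      then have "r * (- 1 / r * ln (w x) - ln s) \<le> r * (w x powr (- 1 / r) / s - 1)"
        using elim pos' by (intro mult_left_mono) (auto simp: ln_div ln_powr)
      moreover have "ln (sqrt (w x) / b) \<le> sqrt (w x) / b - 1"
        using elim pos' by (intro ln_le_minus_one) simp
      then have "ln (w x) / 2 - ln b \<le> sqrt (w x) / b - 1"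
        using elim pos' by (simp add: ln_div ln_sqrt)
      moreover have "r * (- 1 / r * ln (w x) - ln s) = - ln (w x) - r * ln s"
        using pos' by (simp add: algebra_simps)
      moreover have "sqrt (w x) / b * 2 = 2 / b * sqrt (w x)"
        by simp
      ultimately have "r + 2 - K \<le> r / s * w x powr (- 1 / r) + 2 / b * sqrt (w x)"
        unfolding K_def right_diff_distrib by simp
      then have "ennreal (r + 2 - K) \<le> ennreal (r / s * w x powr (- 1 / r) + 2 / b * sqrt (w x))"
        by (rule ennreal_leI)
      also have "\<dots> = ennreal (r / s) * ennreal (w x powr (- 1 / r)) + ennreal (2 / b) * ennreal (sqrt (w x))"
        using pos' elim by (simp flip: ennreal_mult)
      finally show ?case
        by (auto split: split_indicator)
    qed
    then have "(\<integral>\<^sup>+x. ennreal (r + 2 - K) * indicator R x \<partial>M)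
        \<le> (\<integral>\<^sup>+x. ennreal (r / s) * (ennreal (w x powr (- 1 / r)) * indicator R x)
          + ennreal (2 / b) * (ennreal (sqrt (w x)) * indicator R x) \<partial>M)"
      by (rule nn_integral_mono_AE)
    then have "ennreal (r + 2 - K) * ennreal m
        \<le> ennreal (r / s) * ennreal (s * m) + ennreal (2 / b) * ennreal (b * m)"
      using s by (simp add: nn_integral_add nn_integral_cmult nn_integral_cmult_indicator R b)
    also have "\<dots> = ennreal (r / s * (s * m) + 2 / b * (b * m))"
      using pos' by (simp flip: ennreal_mult)
    also have "\<dots> = ennreal ((r + 2) * m)"
      using pos' by (simp add: algebra_simps)
    finally have "ennreal ((r + 2 - K) * m) \<le> ennreal ((r + 2) * m)"
      using pos' K by (simp add: ennreal_mult)
    then have "(r + 2 - K) * m \<le> (r + 2) * m"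
      using pos' by (simp add: ennreal_le_iff)
    then show False
      using K \<open>0 < m\<close> by simp
  qed
  then have "1 \<le> exp K" by simp
  also have "exp K = s powr r * b\<^sup>2"
    using pos' by (simp add: K_def exp_add powr_def exp_double)
  finally show ?thesis .
qed

section \<open>Averages of \<open>w\<close> against squared averages of
  \<open>sqrt w\<close>\<close>

lemma avg_pos:
  assumes "0 < emeasure lebesgue R" "emeasure lebesgue R < \<infinity>"
    and "0 < (\<integral>\<^sup>+x\<in>R. g x \<partial>lebesgue)"
  shows "0 < avg R g"
  using assms by (simp add: avg_def ennreal_zero_less_divide)

lemma avg_mult_emeasure:
  assumes "0 < emeasure lebesgue R" "emeasure lebesgue R < \<infinity>"
  shows "avg R g * emeasure lebesgue R = (\<integral>\<^sup>+x\<in>R. g x \<partial>lebesgue)"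
  using assms by (simp add: avg_def ennreal_divide_times)

text \<open>The condition says that the average of \<open>w\<close> over \<open>S\<close> is at most
  \<open>c * w x\<close> for almost every \<open>x\<close> in \<open>S\<close>. Take square roots
  and average over \<open>R\<close>.\<close>

lemma A_class_1_avg_le:
  fixes w :: "real^'n \<Rightarrow> real"
  assumes w: "is_weight w" and A1: "A1_const w \<le> ennreal c" and c: "0 < c"
    and S: "S \<in> cubes" and R[measurable]: "R \<in> sets lebesgue" and sub: "R \<subseteq> S" and pos: "0 < emeasure lebesgue R"
  shows "avg S (\<lambda>x. ennreal (w x)) \<le> ennreal c * (avg R (\<lambda>x. ennreal (sqrt (w x))))\<^sup>2"
proof -
  have [measurable]: "w \<in> borel_measurable lebesgue"
    using borel_measurable_weight[OF w] .
  have [measurable]: "S \<in> sets lebesgue"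
    using cubes_lebesgue[OF S] .
  have R_fin: "emeasure lebesgue R < \<infinity>"
    using emeasure_mono[OF sub, of lebesgue] emeasure_cubes(2)[OF S] by (simp add: le_less_trans)
  let ?e = "esssup (restrict_space lebesgue S) (\<lambda>x. inverse (ennreal (w x)))"
  have "avg S (\<lambda>x. ennreal (w x)) < \<infinity>"
    using nn_integral_weight_cube(2)[OF w S] emeasure_cubes[OF S]
    by (auto simp: avg_def ennreal_divide_eq_top_iff less_top[symmetric])
  then obtain \<alpha> where \<alpha>: "0 \<le> \<alpha>" "avg S (\<lambda>x. ennreal (w x)) = ennreal \<alpha>"
    by (cases "avg S (\<lambda>x. ennreal (w x))") auto
  have e: "ennreal \<alpha> * ?e \<le> ennreal c"
    unfolding \<alpha>(2)[symmetric] by (rule order_trans[OF SUP_upper[OF S] A1[unfolded A1_const_def]])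
  have "AE x in restrict_space lebesgue S. inverse (ennreal (w x)) \<le> ?e"
    by (rule esssup_AE)
  then have "AE x in lebesgue. x \<in> S \<longrightarrow> inverse (ennreal (w x)) \<le> ?e"
    by (subst (asm) AE_restrict_space_iff) auto
  then have "AE x in lebesgue. ennreal (sqrt \<alpha>) * indicator R x \<le> ennreal (sqrt c) * (ennreal (sqrt (w x)) * indicator R x)"
    using AE_weight_pos[OF w]
  proof eventually_elim
    case (elim x)
    show ?case
    proof (cases "x \<in> R")
      case True
      then have "inverse (ennreal (w x)) \<le> ?e" using elim sub by blast
      then have "ennreal \<alpha> * inverse (ennreal (w x)) \<le> ennreal c"
        by (rule order_trans[OF mult_left_mono e]) simp
      then have "ennreal (\<alpha> / w x) \<le> ennreal c"
        using elim \<alpha> by (simp add: inverse_ennreal divide_inverse flip: ennreal_mult)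
      then have "\<alpha> \<le> c * w x"
        using elim c by (simp add: ennreal_le_iff divide_le_eq)
      then have "sqrt \<alpha> \<le> sqrt c * sqrt (w x)"
        by (simp flip: real_sqrt_mult)
      then have "ennreal (sqrt \<alpha>) \<le> ennreal (sqrt c * sqrt (w x))"
        by (rule ennreal_leI)
      then show ?thesis
        using c elim True by (simp add: ennreal_mult)
    qed simp
  qed
  then have "(\<integral>\<^sup>+x. ennreal (sqrt \<alpha>) * indicator R x \<partial>lebesgue)
      \<le> (\<integral>\<^sup>+x. ennreal (sqrt c) * (ennreal (sqrt (w x)) * indicator R x) \<partial>lebesgue)"
    by (rule nn_integral_mono_AE)
  then have "ennreal (sqrt \<alpha>) * emeasure lebesgue R
      \<le> ennreal (sqrt c) * (\<integral>\<^sup>+x\<in>R. ennreal (sqrt (w x)) \<partial>lebesgue)"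
    by (simp add: nn_integral_cmult nn_integral_cmult_indicator)
  also have "\<dots> = ennreal (sqrt c) * avg R (\<lambda>x. ennreal (sqrt (w x))) * emeasure lebesgue R"
    by (simp only: avg_mult_emeasure[OF pos R_fin] mult.assoc)
  finally have "ennreal (sqrt \<alpha>) \<le> ennreal (sqrt c) * avg R (\<lambda>x. ennreal (sqrt (w x)))"
    using pos R_fin ennreal_mult_le_mult_iff[of "emeasure lebesgue R"]
    by (simp only: mult.commute[of _ "emeasure lebesgue R"]) simp
  then have "(ennreal (sqrt \<alpha>))\<^sup>2 \<le> (ennreal (sqrt c) * avg R (\<lambda>x. ennreal (sqrt (w x))))\<^sup>2"
    by (rule power_mono) simp
  moreover have "(ennreal (sqrt \<alpha>))\<^sup>2 = ennreal \<alpha>" "(ennreal (sqrt c))\<^sup>2 = ennreal c"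
    using \<alpha> c by (simp_all add: ennreal_power)
  ultimately show ?thesis
    unfolding \<alpha>(2) by (simp only: power_mult_distrib)
qed

text \<open>Let \<open>\<sigma>\<close> be \<open>w powr (- 1 / (p - 1))\<close>. Its average over
  \<open>R\<close> is at most \<open>D\<close> times its average over \<open>S\<close>. Inserting
  this into \<open>powr_avg_mult_avg_sqrt_ge_1\<close> on \<open>R\<close> and multiplying by the
  average of \<open>w\<close> over \<open>S\<close> brings in the \<open>Ap_const\<close> bound on
  \<open>S\<close>.\<close>

lemma A_class_gt_1_avg_le:
  fixes w :: "real^'n \<Rightarrow> real"
  assumes w: "is_weight w" and p: "1 < p" and Ap: "Ap_const p w \<le> ennreal c" and c: "0 < c"
    and S: "S \<in> cubes" and R[measurable]: "R \<in> sets lebesgue" and sub: "R \<subseteq> S"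
    and D: "0 < D" and ratio: "emeasure lebesgue S \<le> ennreal D * emeasure lebesgue R"
  shows "avg S (\<lambda>x. ennreal (w x)) \<le> ennreal (c * D powr (p - 1)) * (avg R (\<lambda>x. ennreal (sqrt (w x))))\<^sup>2"
proof -
  have [measurable]: "w \<in> borel_measurable lebesgue"
    using borel_measurable_weight[OF w] .
  have [measurable]: "S \<in> sets lebesgue"
    using cubes_lebesgue[OF S] .
  define r where "r = p - 1"
  have r: "0 < r" "1 - p / r = - 1 / r"
    using p by (auto simp: r_def field_simps)
  have R_pos: "0 < emeasure lebesgue R"
    using ratio emeasure_cubes(1)[OF S] by (auto simp: zero_less_iff_neq_zero)
  have R_fin: "emeasure lebesgue R < \<infinity>"
    using emeasure_mono[OF sub, of lebesgue] emeasure_cubes(2)[OF S] by (simp add: le_less_trans)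
  obtain m where m: "0 < m" "emeasure lebesgue R = ennreal m"
    using R_pos R_fin by (cases "emeasure lebesgue R") auto
  obtain q where q: "0 < q" "emeasure lebesgue S = ennreal q"
    using emeasure_cubes[OF S] by (cases "emeasure lebesgue S") auto
  let ?\<sigma> = "\<lambda>x. ennreal (w x powr (- 1 / r))"
  have \<sigma>_pos: "AE x in lebesgue. 0 < ?\<sigma> x" and sqrt_pos: "AE x in lebesgue. 0 < ennreal (sqrt (w x))"
    using AE_weight_pos[OF w] by (eventually_elim, simp)+
  have "0 < avg S (\<lambda>x. ennreal (w x))"
    by (intro avg_pos emeasure_cubes S nn_integral_weight_cube w)
  moreover have "avg S (\<lambda>x. ennreal (w x)) < \<infinity>"
    using nn_integral_weight_cube(2)[OF w S] emeasure_cubes[OF S]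
    by (auto simp: avg_def ennreal_divide_eq_top_iff less_top[symmetric])
  ultimately obtain \<alpha> where \<alpha>: "0 < \<alpha>" "avg S (\<lambda>x. ennreal (w x)) = ennreal \<alpha>"
    by (cases "avg S (\<lambda>x. ennreal (w x))") auto
  have bound: "ennreal \<alpha> * ennreal_powr (avg S ?\<sigma>) r \<le> ennreal c"
    using order_trans[OF SUP_upper[OF S] Ap[unfolded Ap_const_def]]
    unfolding \<alpha>(2) r_def[symmetric] r(2) .
  \<comment> \<open>An infinite average would make the product in \<open>bound\<close> infinite,
    because \<open>ennreal_powr\<close> preserves \<open>\<infinity>\<close> and
    \<open>\<alpha>\<close> is positive.\<close>
  have "avg S ?\<sigma> \<noteq> \<infinity>"
  proof
    assume "avg S ?\<sigma> = \<infinity>"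
    then have "ennreal \<alpha> * ennreal_powr (avg S ?\<sigma>) r = \<infinity>"
      using \<alpha>(1) by (simp add: ennreal_powr_def ennreal_mult_eq_top_iff)
    with bound show False by (simp add: top_unique)
  qed
  then obtain t where t: "0 \<le> t" "avg S ?\<sigma> = ennreal t"
    by (cases "avg S ?\<sigma>") auto
  have bound': "\<alpha> * t powr r \<le> c"
    using bound t \<alpha> c by (simp add: ennreal_powr_def flip: ennreal_mult)
  have "(\<integral>\<^sup>+x\<in>R. ?\<sigma> x \<partial>lebesgue) \<le> (\<integral>\<^sup>+x\<in>S. ?\<sigma> x \<partial>lebesgue)"
    using sub by (intro nn_integral_mono) (auto split: split_indicator)
  also have "\<dots> = ennreal (t * q)"
    using avg_mult_emeasure[OF emeasure_cubes[OF S], of ?\<sigma>] t q by (simp add: ennreal_mult)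
  finally have \<sigma>R: "(\<integral>\<^sup>+x\<in>R. ?\<sigma> x \<partial>lebesgue) \<le> ennreal (t * q)" .
  have "0 < (\<integral>\<^sup>+x\<in>R. ?\<sigma> x \<partial>lebesgue)"
    using \<sigma>_pos R_pos by (intro nn_integral_pos_if_AE_pos) auto
  with \<sigma>R obtain z where z: "0 < z" "(\<integral>\<^sup>+x\<in>R. ?\<sigma> x \<partial>lebesgue) = ennreal z"
    by (cases "\<integral>\<^sup>+x\<in>R. ?\<sigma> x \<partial>lebesgue") (auto simp: top_unique)
  have "q \<le> D * m"
    using ratio D m q by (simp flip: ennreal_mult)
  have "z \<le> t * q"
    using \<sigma>R z t q by simp
  also have "\<dots> \<le> t * (D * m)"
    using t \<open>q \<le> D * m\<close> by (intro mult_left_mono)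
  finally have zm: "z / m \<le> t * D"
    using m by (simp add: divide_le_eq mult.assoc)
  let ?b = "avg R (\<lambda>x. ennreal (sqrt (w x)))"
  have b_int: "?b * ennreal m = (\<integral>\<^sup>+x\<in>R. ennreal (sqrt (w x)) \<partial>lebesgue)"
    using avg_mult_emeasure[OF R_pos R_fin] m by simp
  show ?thesis
  proof (cases ?b)
    case top
    then have "ennreal (c * D powr (p - 1)) * ?b\<^sup>2 = top"
      using c D by (simp add: ennreal_mult_eq_top_iff power_eq_top_ennreal)
    then show ?thesis by (simp only: top_greatest)
  next
    case (real b)
    have "0 < ?b"
      using sqrt_pos R_pos R_fin by (intro avg_pos nn_integral_pos_if_AE_pos) auto
    with real have b: "0 < b" by simp
    have "1 \<le> (z / m) powr r * b\<^sup>2"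
    proof (rule powr_avg_mult_avg_sqrt_ge_1[where M = lebesgue and w = w and R = R and m = m])
      show "(\<integral>\<^sup>+x\<in>R. ?\<sigma> x \<partial>lebesgue) = ennreal (z / m * m)"
        using z m by simp
      show "(\<integral>\<^sup>+x\<in>R. ennreal (sqrt (w x)) \<partial>lebesgue) = ennreal (b * m)"
        using b_int real b m by (simp add: ennreal_mult)
    qed (use AE_weight_pos[OF w] r z m b in auto)
    also have "\<dots> \<le> (t * D) powr r * b\<^sup>2"
      using zm z m r by (intro mult_right_mono powr_mono2) auto
    finally have "\<alpha> * 1 \<le> \<alpha> * ((t * D) powr r * b\<^sup>2)"
      using \<alpha> by (intro mult_left_mono) auto
    also have "\<dots> = (\<alpha> * t powr r) * (D powr r * b\<^sup>2)"
      using t D by (simp add: powr_mult)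
    also have "\<dots> \<le> c * (D powr r * b\<^sup>2)"
      by (intro mult_right_mono bound') auto
    finally have "ennreal \<alpha> \<le> ennreal (c * D powr r * b\<^sup>2)"
      by (intro ennreal_leI) simp
    then show ?thesis
      using \<alpha> real b c by (simp add: ennreal_mult ennreal_power flip: r_def)
  qed
qed

text \<open>Merges the cases \<open>p = 1\<close> and \<open>p > 1\<close> into a single constant
  that does not depend on \<open>S\<close> and \<open>R\<close>.\<close>

lemma A_infinity_avg_le:
  fixes w :: "real^'n \<Rightarrow> real"
  assumes "w \<in> A_infinity" and D: "0 < D"
  obtains C where "0 < C"
    and "\<And>S R. \<lbrakk>S \<in> cubes; R \<in> sets lebesgue; R \<subseteq> S; emeasure lebesgue S \<le> ennreal D * emeasure lebesgue R\<rbrakk>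
      \<Longrightarrow> avg S (\<lambda>x. ennreal (w x)) \<le> ennreal C * (avg R (\<lambda>x. ennreal (sqrt (w x))))\<^sup>2"
proof -
  obtain p where p: "1 \<le> p" "w \<in> A_class p"
    using assms unfolding A_infinity_def by auto
  then have w: "is_weight w"
    unfolding A_class_def by simp
  show thesis
  proof (cases "p = 1")
    case True
    then obtain c where "0 \<le> c" "A1_const w = ennreal c"
      using p unfolding A_class_def by (cases "A1_const w") auto
    \<comment> \<open>Adding \<open>1\<close> makes the constant strictly positive.\<close>
    then have c: "A1_const w \<le> ennreal (c + 1)" "0 < c + 1"
      by (auto simp: ennreal_leI)
    show thesis
    proof (rule that[OF c(2)])
      fix S R :: "(real^'n) set"
      assume *: "S \<in> cubes" "R \<in> sets lebesgue" "R \<subseteq> S" "emeasure lebesgue S \<le> ennreal D * emeasure lebesgue R"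
      then have "0 < emeasure lebesgue R"
        using emeasure_cubes(1)[of S] by (auto simp: zero_less_iff_neq_zero)
      with * show "avg S (\<lambda>x. ennreal (w x)) \<le> ennreal (c + 1) * (avg R (\<lambda>x. ennreal (sqrt (w x))))\<^sup>2"
        by (intro A_class_1_avg_le w c)
    qed
  next
    case False
    then obtain c where "0 \<le> c" "Ap_const p w = ennreal c"
      using p unfolding A_class_def by (cases "Ap_const p w") auto
    then have c: "Ap_const p w \<le> ennreal (c + 1)" "0 < c + 1"
      by (auto simp: ennreal_leI)
    show thesis
    proof (rule that)
      show "0 < (c + 1) * D powr (p - 1)"
        using c D by simp
    qed (use False p in \<open>intro A_class_gt_1_avg_le w c D, auto\<close>)
  qed
qed

section \<open>Finiteness of the Fujii--Wilson constant\<close>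

lemma nn_integral_abs_restricted_weight:
  fixes w :: "real^'n \<Rightarrow> real"
  assumes "is_weight w" "A \<inter> Q = B"
  shows "(\<integral>\<^sup>+y\<in>A. ennreal \<bar>w y * indicator Q y\<bar> \<partial>lebesgue) = (\<integral>\<^sup>+y\<in>B. ennreal (w y) \<partial>lebesgue)"
  using AE_weight_pos[OF assms(1)]
  by (intro nn_integral_cong_AE, eventually_elim) (use assms(2) in \<open>auto split: split_indicator\<close>)

context dyadic_grid
begin

text \<open>If \<open>l \<le> h\<close>, choose the level whose side lies between \<open>l\<close>
  and \<open>2 * l\<close>: a cube of side \<open>l\<close> through \<open>x\<close> leaves the cell
  around \<open>x\<close> by at most one side length in each direction. If \<open>h < l\<close>,
  level \<open>0\<close> works, since only the part inside the large cube has to be covered.\<close>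

lemma cube_covered_by_enlarged_cell:
  fixes l :: real
  assumes "0 < l" and x: "x \<in> cell 0 a" "x \<in> cbox c (c + (\<chi> i. l))"
  obtains k where "h / 2 ^ k \<le> 2 * l"
    and "cbox c (c + (\<chi> i. l)) \<inter> cbox a (a + (\<chi> i. h))
      \<subseteq> cbox (corner k x - (\<chi> i. h / 2 ^ k)) (corner k x - (\<chi> i. h / 2 ^ k) + (\<chi> i. 3 * (h / 2 ^ k)))"
proof (cases "h < l")
  case True
  have "corner 0 x = a"
    using x(1) corner_0_self by (simp add: corner_def cell_def)
  then show thesis
  proof (intro that[of 0] subsetI)
    fix y assume "y \<in> cbox c (c + (\<chi> i. l)) \<inter> cbox a (a + (\<chi> i. h))"
    then have y: "a $ i \<le> y $ i \<and> y $ i \<le> a $ i + h" for i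
      by (simp add: mem_box_cart)
    have "a $ i - h \<le> y $ i \<and> y $ i \<le> a $ i - h + 3 * h" for i
      using y[of i] h_pos by linarith
    then show "y \<in> cbox (corner 0 x - (\<chi> i. h / 2 ^ 0)) (corner 0 x - (\<chi> i. h / 2 ^ 0) + (\<chi> i. 3 * (h / 2 ^ 0)))"
      using \<open>corner 0 x = a\<close> by (simp add: mem_box_cart)
  qed (use True h_pos in simp)
next
  case False
  have "(\<lambda>j. h * (1 / 2) ^ j) \<longlonglongrightarrow> h * 0"
    by (intro tendsto_intros LIMSEQ_power_zero) auto
  then have "\<forall>\<^sub>F j in sequentially. h * (1 / 2) ^ j < l"
    using \<open>0 < l\<close> by (auto dest: order_tendstoD(2))
  then obtain j0 where "h * (1 / 2) ^ j0 < l"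
    by (meson eventually_happens sequentially_bot)
  then have ex: "h / 2 ^ j0 < l"
    by (simp add: field_simps)
  \<comment> \<open>The first level with side below \<open>l\<close> is not \<open>0\<close> because
    \<open>l \<le> h\<close>; its predecessor \<open>k\<close> is the level wanted.\<close>
  define j where "j = (LEAST j. h / 2 ^ j < l)"
  have j: "h / 2 ^ j < l"
    unfolding j_def using ex by (rule LeastI)
  then have "j \<noteq> 0"
    using False by (intro notI) simp
  then obtain k where k: "j = Suc k"
    using not0_implies_Suc by blast
  have "\<not> h / 2 ^ k < l"
    using not_less_Least[of k "\<lambda>j. h / 2 ^ j < l"] k unfolding j_def by simp
  then have lk: "l \<le> h / 2 ^ k" by simp
  show thesis
  proof (rule that[of k])
    show "h / 2 ^ k \<le> 2 * l"
      using j k by (simp add: field_simps)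
    have xk: "corner k x $ i \<le> x $ i \<and> x $ i < corner k x $ i + h / 2 ^ k" for i
      using self_in_cell[of x k] unfolding mem_cell_iff by simp
    have xc: "c $ i \<le> x $ i \<and> x $ i \<le> c $ i + l" for i
      using x(2) by (simp add: mem_box_cart)
    show "cbox c (c + (\<chi> i. l)) \<inter> cbox a (a + (\<chi> i. h))
      \<subseteq> cbox (corner k x - (\<chi> i. h / 2 ^ k)) (corner k x - (\<chi> i. h / 2 ^ k) + (\<chi> i. 3 * (h / 2 ^ k)))"
    proof
      fix y assume "y \<in> cbox c (c + (\<chi> i. l)) \<inter> cbox a (a + (\<chi> i. h))"
      then have yc: "c $ i \<le> y $ i \<and> y $ i \<le> c $ i + l" for i
        by (simp add: mem_box_cart)
      have "corner k x $ i - h / 2 ^ k \<le> y $ i \<and> y $ i \<le> corner k x $ i - h / 2 ^ k + 3 * (h / 2 ^ k)" for i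
        using xk[of i] xc[of i] yc[of i] lk by linarith
      then show "y \<in> cbox (corner k x - (\<chi> i. h / 2 ^ k)) (corner k x - (\<chi> i. h / 2 ^ k) + (\<chi> i. 3 * (h / 2 ^ k)))"
        by (simp add: mem_box_cart)
    qed
  qed
qed

text \<open>A competing cube \<open>P\<close> of side \<open>l\<close> is replaced by the tripled
  cell \<open>S\<close>, whose side is at most \<open>6 * l\<close>; this costs
  \<open>6 ^ CARD('n)\<close>. The cell itself fills a fraction \<open>1 / 3 ^ CARD('n)\<close> of
  \<open>S\<close>, so \<open>avg_le\<close> passes to \<open>sqrt w\<close> on the cell.\<close>

lemma maximal_le_dyadic_maximal_sqrt:
  fixes w :: "real^'n \<Rightarrow> real"
  assumes w: "is_weight w" and C: "0 < C"
    and avg_le: "\<And>S R. \<lbrakk>S \<in> cubes; R \<in> sets lebesgue; R \<subseteq> S;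
        emeasure lebesgue S \<le> ennreal (3 ^ CARD('n)) * emeasure lebesgue R\<rbrakk>
      \<Longrightarrow> avg S (\<lambda>x. ennreal (w x)) \<le> ennreal C * (avg R (\<lambda>x. ennreal (sqrt (w x))))\<^sup>2"
    and x: "x \<in> cell 0 a"
  shows "maximal (\<lambda>y. w y * indicator (cbox a (a + (\<chi> i. h))) y) x
    \<le> ennreal (6 ^ CARD('n) * C) * (dyadic_maximal (\<lambda>y. ennreal (sqrt (w y)) * indicator (cell 0 a) y) x)\<^sup>2"
  unfolding maximal_def
proof (rule SUP_least)
  let ?Q = "cbox a (a + (\<chi> i. h))"
  let ?g = "\<lambda>y. ennreal (sqrt (w y)) * indicator (cell 0 a) y"
  fix P assume "P \<in> {P \<in> cubes. x \<in> P}"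
  then obtain c l where P: "P = cbox c (c + (\<chi> i. l))" "0 < l" "x \<in> P"
    unfolding cubes_def by blast
  obtain k where k: "h / 2 ^ k \<le> 2 * l"
    and cover: "P \<inter> ?Q \<subseteq> cbox (corner k x - (\<chi> i. h / 2 ^ k)) (corner k x - (\<chi> i. h / 2 ^ k) + (\<chi> i. 3 * (h / 2 ^ k)))"
    using cube_covered_by_enlarged_cell[OF P(2) x] P(1,3) by metis
  define s where "s = h / 2 ^ k"
  have s: "0 < s" using h_pos by (simp add: s_def)
  define S where "S = cbox (corner k x - (\<chi> i. s)) (corner k x - (\<chi> i. s) + (\<chi> i. 3 * s))"
  have S: "S \<in> cubes"
    using s unfolding S_def cubes_def by (auto intro!: exI[of _ "3 * s"])
  have P_measure: "emeasure lebesgue P = ennreal (l ^ CARD('n))"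
    unfolding P(1) using P(2) by (intro emeasure_cube) simp
  have S_measure: "emeasure lebesgue S = ennreal ((3 * s) ^ CARD('n))"
    unfolding S_def using s by (intro emeasure_cube) simp
  have cell_S: "cell k x \<subseteq> S"
  proof
    fix y assume "y \<in> cell k x"
    then have y: "corner k x $ i \<le> y $ i \<and> y $ i < corner k x $ i + s" for i
      unfolding mem_cell_iff s_def by simp
    have "corner k x $ i - s \<le> y $ i \<and> y $ i \<le> corner k x $ i - s + 3 * s" for i
      using y[of i] s by linarith
    then show "y \<in> S"
      by (simp add: S_def mem_box_cart)
  qed
  have "(\<integral>\<^sup>+y\<in>P. ennreal \<bar>w y * indicator ?Q y\<bar> \<partial>lebesgue) = (\<integral>\<^sup>+y\<in>P \<inter> ?Q. ennreal (w y) \<partial>lebesgue)"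
    by (rule nn_integral_abs_restricted_weight[OF w refl])
  also have "\<dots> \<le> (\<integral>\<^sup>+y\<in>S. ennreal (w y) \<partial>lebesgue)"
    using cover unfolding S_def s_def by (intro nn_integral_mono) (auto split: split_indicator)
  also have "\<dots> = avg S (\<lambda>y. ennreal (w y)) * emeasure lebesgue S"
    by (rule avg_mult_emeasure[OF emeasure_cubes[OF S], symmetric])
  also have "\<dots> \<le> avg S (\<lambda>y. ennreal (w y)) * (ennreal (6 ^ CARD('n)) * emeasure lebesgue P)"
  proof (rule mult_left_mono)
    have "(3 * s) ^ CARD('n) \<le> (6 * l) ^ CARD('n)"
      using k s by (intro power_mono) (auto simp: s_def)
    then show "emeasure lebesgue S \<le> ennreal (6 ^ CARD('n)) * emeasure lebesgue P"
      unfolding S_measure P_measure using P(2)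
      by (simp add: power_mult_distrib flip: ennreal_mult)
  qed simp
  finally have "(\<integral>\<^sup>+y\<in>P. ennreal \<bar>w y * indicator ?Q y\<bar> \<partial>lebesgue)
      \<le> emeasure lebesgue P * (ennreal (6 ^ CARD('n)) * avg S (\<lambda>y. ennreal (w y)))"
    by (simp only: mult_ac)
  then have "avg P (\<lambda>y. ennreal \<bar>w y * indicator ?Q y\<bar>) \<le> ennreal (6 ^ CARD('n)) * avg S (\<lambda>y. ennreal (w y))"
    unfolding avg_def[of P] using P(2) by (intro divide_le_posI_ennreal) (simp add: P_measure)
  also have "avg S (\<lambda>y. ennreal (w y)) \<le> ennreal C * (avg (cell k x) (\<lambda>y. ennreal (sqrt (w y))))\<^sup>2"
    using s by (intro avg_le S cell_S cell_lebesgue)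
      (simp add: S_measure emeasure_cell power_mult_distrib ennreal_mult flip: s_def)
  \<comment> \<open>The cell lies inside \<open>cell 0 a\<close>, so cutting \<open>sqrt w\<close>
    off there changes nothing. The cutoff is what Doob's inequality will be applied to.\<close>
  also have "avg (cell k x) (\<lambda>y. ennreal (sqrt (w y))) = avg (cell k x) ?g"
    unfolding avg_def using cell_antimono[of 0 k x] cell_eq[OF x]
    by (intro arg_cong2[where f = "(/)"] nn_integral_cong refl) (auto split: split_indicator)
  also have "avg (cell k x) ?g \<le> dyadic_maximal ?g x"
    unfolding dyadic_maximal_def by (intro SUP_upper) simp
  finally have "avg P (\<lambda>y. ennreal \<bar>w y * indicator ?Q y\<bar>)
      \<le> ennreal (6 ^ CARD('n)) * (ennreal C * (dyadic_maximal ?g x)\<^sup>2)"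
    by (simp add: mult_left_mono power_mono)
  then show "avg P (\<lambda>y. ennreal \<bar>w y * indicator ?Q y\<bar>)
      \<le> ennreal (6 ^ CARD('n) * C) * (dyadic_maximal ?g x)\<^sup>2"
    using C by (simp add: ennreal_mult mult.assoc flip: ennreal_power)
qed

lemma set_nn_integral_cell_0:
  "(\<integral>\<^sup>+x\<in>cell 0 a. f x \<partial>lebesgue) = (\<integral>\<^sup>+x\<in>cbox a (a + (\<chi> i. h)). f x \<partial>lebesgue)"
  using AE_cbox_iff_cell[of 0 a]
  by (intro nn_integral_cong_AE, eventually_elim) (auto split: split_indicator)

end

text \<open>Doob's inequality is applied to \<open>sqrt w\<close> cut off to the cube, whose square
  integrates back to \<open>w(Q)\<close>. The factor \<open>4\<close> is Doob's constant.\<close>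

lemma fw_ratio_bounded:
  fixes w :: "real^'n \<Rightarrow> real"
  assumes "w \<in> A_infinity"
  obtains B where "\<And>Q. Q \<in> cubes \<Longrightarrow> fw_ratio w Q \<le> ennreal B"
proof -
  have w: "is_weight w"
    using assms by (auto simp: A_infinity_def A_class_def)
  have [measurable]: "w \<in> borel_measurable lebesgue"
    using borel_measurable_weight[OF w] .
  obtain C where C: "0 < C" and avg_le: "\<And>S R. \<lbrakk>S \<in> cubes; R \<in> sets lebesgue; R \<subseteq> S;
        emeasure lebesgue S \<le> ennreal (3 ^ CARD('n)) * emeasure lebesgue R\<rbrakk>
      \<Longrightarrow> avg S (\<lambda>x. ennreal (w x)) \<le> ennreal C * (avg R (\<lambda>x. ennreal (sqrt (w x))))\<^sup>2"
    using A_infinity_avg_le[OF assms, of "3 ^ CARD('n)"] by auto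
  have "fw_ratio w Q \<le> ennreal (6 ^ CARD('n) * C * 4)" if Q: "Q \<in> cubes" for Q :: "(real^'n) set"
  proof -
    obtain a h where ah: "Q = cbox a (a + (\<chi> i. h))" "0 < h"
      using Q unfolding cubes_def by blast
    interpret dyadic_grid a h
      by unfold_locales (rule ah(2))
    let ?g = "\<lambda>y. ennreal (sqrt (w y)) * indicator (cell 0 a) y"
    let ?W = "\<integral>\<^sup>+x\<in>Q. ennreal (w x) \<partial>lebesgue"
    let ?K = "ennreal (6 ^ CARD('n) * C)"
    have g_sq: "(\<integral>\<^sup>+x. (?g x)\<^sup>2 \<partial>lebesgue) = ?W"
    proof -
      have "(\<integral>\<^sup>+x. (?g x)\<^sup>2 \<partial>lebesgue) = (\<integral>\<^sup>+x\<in>cell 0 a. ennreal (w x) \<partial>lebesgue)"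
        using AE_weight_pos[OF w]
        by (intro nn_integral_cong_AE, eventually_elim) (auto simp: ennreal_power split: split_indicator)
      then show ?thesis
        by (simp add: set_nn_integral_cell_0 ah)
    qed
    \<comment> \<open>On a set of finite measure, square integrability gives integrability through
      \<open>t \<le> 1 + t\<^sup>2\<close>.\<close>
    have g_fin: "(\<integral>\<^sup>+x. ?g x \<partial>lebesgue) < \<infinity>"
    proof -
      have "(\<integral>\<^sup>+x. ?g x \<partial>lebesgue) \<le> (\<integral>\<^sup>+x. indicator (cell 0 a) x + (?g x)\<^sup>2 \<partial>lebesgue)"
      proof (rule nn_integral_mono)
        fix x
        have "sqrt (w x) \<le> 1 + (sqrt (w x))\<^sup>2"
          using zero_le_power2[of "sqrt (w x) - 1 / 2"] by (simp add: power2_eq_square algebra_simps)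
        then have "ennreal (sqrt (w x)) \<le> ennreal (1 + (sqrt (w x))\<^sup>2)"
          by (rule ennreal_leI)
        also have "\<dots> \<le> 1 + (ennreal (sqrt (w x)))\<^sup>2" if "0 \<le> w x"
          using that by (simp add: ennreal_power)
        finally have "ennreal (sqrt (w x)) \<le> 1 + (ennreal (sqrt (w x)))\<^sup>2"
          by (cases "0 \<le> w x") (simp_all add: ennreal_neg)
        then show "?g x \<le> indicator (cell 0 a) x + (?g x)\<^sup>2"
          by (auto split: split_indicator)
      qed
      also have "\<dots> = emeasure lebesgue (cell 0 a) + ?W"
        unfolding g_sq[symmetric] by (simp add: nn_integral_add)
      also have "\<dots> < \<infinity>"
        using nn_integral_weight_cube(2)[OF w Q] emeasure_cell_finite[of 0 a] by (auto simp: less_top)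
      finally show ?thesis .
    qed
    have "(\<integral>\<^sup>+x\<in>Q. maximal (\<lambda>y. w y * indicator Q y) x \<partial>lebesgue)
        = (\<integral>\<^sup>+x\<in>cell 0 a. maximal (\<lambda>y. w y * indicator Q y) x \<partial>lebesgue)"
      by (simp add: set_nn_integral_cell_0 ah)
    also have "\<dots> \<le> (\<integral>\<^sup>+x. ?K * (dyadic_maximal ?g x)\<^sup>2 \<partial>lebesgue)"
    proof (rule nn_integral_mono)
      fix x
      show "maximal (\<lambda>y. w y * indicator Q y) x * indicator (cell 0 a) x \<le> ?K * (dyadic_maximal ?g x)\<^sup>2"
      proof (cases "x \<in> cell 0 a")
        case True
        have "maximal (\<lambda>y. w y * indicator Q y) x \<le> ?K * (dyadic_maximal ?g x)\<^sup>2"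
          unfolding ah(1) by (rule maximal_le_dyadic_maximal_sqrt[OF w C _ True]) (rule avg_le)
        then show ?thesis
          using True by simp
      qed simp
    qed
    also have "\<dots> = ?K * (\<integral>\<^sup>+x. (dyadic_maximal ?g x)\<^sup>2 \<partial>lebesgue)"
      by (intro nn_integral_cmult) measurable
    also have "\<dots> \<le> ?K * (4 * (\<integral>\<^sup>+x. (?g x)\<^sup>2 \<partial>lebesgue))"
      by (intro mult_left_mono doob_L2 g_fin) simp_all
    also have "\<dots> = ennreal (6 ^ CARD('n) * C * 4) * ?W"
      unfolding g_sq using C by (simp add: ennreal_mult mult.assoc)
    finally show ?thesis
      unfolding fw_ratio_def emeasure_wmeasure_cube[OF w Q]
      using nn_integral_weight_cube[OF w Q] by (intro divide_le_posI_ennreal) (auto simp: mult.commute)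
  qed
  then show thesis by (rule that)
qed

section \<open>Oscillation of the logarithm\<close>

lemma nn_integral_wmeasure:
  assumes w: "is_weight w" and [measurable]: "Q \<in> sets lebesgue" "f \<in> borel_measurable lebesgue"
  shows "(\<integral>\<^sup>+x\<in>Q. f x \<partial>wmeasure w) = (\<integral>\<^sup>+x\<in>Q. f x * ennreal (w x) \<partial>lebesgue)"
proof -
  have [measurable]: "w \<in> borel_measurable lebesgue"
    using borel_measurable_weight[OF w] .
  show ?thesis
    unfolding wmeasure_def by (subst nn_integral_density) (auto simp: mult_ac)
qed

lemma sets_wmeasure [simp]: "sets (wmeasure w) = sets lebesgue"
  by (simp add: wmeasure_def)

text \<open>The weighted mean of \<open>f\<close> lies within \<open>T / W\<close> of
  \<open>c\<close>, so replacing \<open>c\<close> by the mean adds at most another \<open>T\<close>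
  to the integral.\<close>

lemma wosc_le:
  fixes w f :: "real^'n \<Rightarrow> real"
  assumes w: "is_weight w" and Q: "Q \<in> cubes" and f[measurable]: "f \<in> borel_measurable lebesgue"
    and T: "(\<integral>\<^sup>+x\<in>Q. ennreal \<bar>f x - c\<bar> \<partial>wmeasure w) \<le> ennreal T" and T_nonneg: "0 \<le> T"
    and W: "emeasure (wmeasure w) Q = ennreal W" "0 < W"
  shows "set_integrable (wmeasure w) Q f" and "wosc w Q f \<le> ennreal (2 * T / W)"
proof -
  let ?\<mu> = "wmeasure w"
  have [measurable]: "Q \<in> sets ?\<mu>" "f \<in> borel_measurable ?\<mu>"
    using cubes_lebesgue[OF Q] f by (simp_all add: wmeasure_def)
  have norm_eq: "(\<integral>\<^sup>+x. ennreal (norm (indicator Q x *\<^sub>R (f x - c))) \<partial>?\<mu>) = (\<integral>\<^sup>+x\<in>Q. ennreal \<bar>f x - c\<bar> \<partial>?\<mu>)"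
    by (intro nn_integral_cong) (auto split: split_indicator)
  have int: "set_integrable ?\<mu> Q (\<lambda>x. f x - c)"
    unfolding set_integrable_def
  proof (rule integrableI_bounded)
    show "(\<integral>\<^sup>+x. ennreal (norm (indicator Q x *\<^sub>R (f x - c))) \<partial>?\<mu>) < \<infinity>"
      unfolding norm_eq using T by (rule le_less_trans) simp
  qed measurable
  have const: "set_integrable ?\<mu> Q (\<lambda>x. c)"
    unfolding set_integrable_def using W
    by (intro integrable_scaleR_left integrable_real_indicator) (auto simp: cubes_lebesgue[OF Q])
  from set_integral_add(1)[OF int const] show f_int: "set_integrable ?\<mu> Q f"
    by simp
  have measure_Q: "measure ?\<mu> Q = W"
    using W by (simp add: measure_def)
  have "(LINT x:Q|?\<mu>. f x) = (LINT x:Q|?\<mu>. f x - c) + (LINT x:Q|?\<mu>. c)"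
    using set_integral_add(2)[OF int const] by simp
  also have "(LINT x:Q|?\<mu>. c) = W * c"
    using cubes_lebesgue[OF Q] W by (subst set_integral_const) (simp_all add: measure_Q)
  finally have mean: "wmean w Q f - c = (LINT x:Q|?\<mu>. f x - c) / W"
    unfolding wmean_def measure_Q using W by (simp add: field_simps)
  have "ennreal \<bar>LINT x:Q|?\<mu>. f x - c\<bar> \<le> (\<integral>\<^sup>+x. ennreal (norm (indicator Q x *\<^sub>R (f x - c))) \<partial>?\<mu>)"
    using integral_norm_bound_ennreal[OF int[unfolded set_integrable_def]]
    unfolding set_lebesgue_integral_def by simp
  also have "\<dots> \<le> ennreal T"
    unfolding norm_eq by (rule T)
  finally have "\<bar>LINT x:Q|?\<mu>. f x - c\<bar> \<le> T"
    using T_nonneg by simp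
  then have dist: "\<bar>wmean w Q f - c\<bar> \<le> T / W"
    unfolding mean using W by (simp add: abs_divide divide_right_mono)
  have "(\<integral>\<^sup>+x\<in>Q. ennreal \<bar>f x - wmean w Q f\<bar> \<partial>?\<mu>)
      \<le> (\<integral>\<^sup>+x. ennreal \<bar>f x - c\<bar> * indicator Q x + ennreal (T / W) * indicator Q x \<partial>?\<mu>)"
  proof (rule nn_integral_mono)
    fix x
    have "ennreal \<bar>f x - wmean w Q f\<bar> \<le> ennreal (\<bar>f x - c\<bar> + T / W)"
      using dist by (intro ennreal_leI) linarith
    also have "\<dots> = ennreal \<bar>f x - c\<bar> + ennreal (T / W)"
      using T_nonneg W by simp
    finally show "ennreal \<bar>f x - wmean w Q f\<bar> * indicator Q x
        \<le> ennreal \<bar>f x - c\<bar> * indicator Q x + ennreal (T / W) * indicator Q x"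
      by (auto split: split_indicator)
  qed
  also have "\<dots> = (\<integral>\<^sup>+x\<in>Q. ennreal \<bar>f x - c\<bar> \<partial>?\<mu>) + ennreal (T / W) * ennreal W"
    by (simp add: nn_integral_add nn_integral_cmult_indicator W cubes_lebesgue[OF Q])
  also have "\<dots> \<le> ennreal T + ennreal T"
    using T T_nonneg W by (intro add_mono) (simp_all flip: ennreal_mult)
  also have "\<dots> = ennreal W * ennreal (2 * T / W)"
    using T_nonneg W by (simp flip: ennreal_mult ennreal_plus)
  finally show "wosc w Q f \<le> ennreal (2 * T / W)"
    unfolding wosc_def W(1) using W(2) by (intro divide_le_posI_ennreal) auto
qed

text \<open>Apply \<open>wosc_le\<close> with \<open>c = ln l\<close>, where \<open>l\<close> is the
  unweighted mean of \<open>w\<close> over \<open>Q\<close>. The positive part of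
  \<open>ln (w x / l)\<close> is controlled by \<open>maximal_LlogL\<close>, the negative part by
  the positive one.\<close>

lemma log_oscillation:
  fixes w :: "real^'n \<Rightarrow> real"
  assumes w: "is_weight w" and Q: "Q \<in> cubes" and F: "fw_ratio w Q = ennreal F" "0 \<le> F"
  shows "set_integrable (wmeasure w) Q (\<lambda>x. ln (w x))" and "1 \<le> F"
    and "wosc w Q (\<lambda>x. ln (w x)) \<le> ennreal (2 ^ (CARD('n) + 3) * (F - 1))"
proof -
  have w_meas[measurable]: "w \<in> borel_measurable lebesgue"
    using borel_measurable_weight[OF w] .
  have Q_sets[measurable]: "Q \<in> sets lebesgue"
    using cubes_lebesgue[OF Q] .
  obtain a h where ah: "Q = cbox a (a + (\<chi> i. h))" "0 < h"
    using Q unfolding cubes_def by blast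
  interpret dyadic_grid a h
    by unfold_locales (rule ah(2))
  have cell_Q: "(\<integral>\<^sup>+x\<in>cell 0 a. f x \<partial>lebesgue) = (\<integral>\<^sup>+x\<in>Q. f x \<partial>lebesgue)" for f
    unfolding ah(1) by (rule set_nn_integral_cell_0)
  define f where "f y = w y * indicator Q y" for y
  have [measurable]: "f \<in> borel_measurable lebesgue"
    unfolding f_def by measurable
  obtain W where W: "0 < W" "(\<integral>\<^sup>+x\<in>Q. ennreal (w x) \<partial>lebesgue) = ennreal W"
    using nn_integral_weight_cube[OF w Q] by (cases "\<integral>\<^sup>+x\<in>Q. ennreal (w x) \<partial>lebesgue") auto
  have \<mu>Q: "emeasure (wmeasure w) Q = ennreal W"
    using emeasure_wmeasure_cube[OF w Q] W by simp
  have f_Q: "(\<integral>\<^sup>+y\<in>Q. ennreal \<bar>f y\<bar> \<partial>lebesgue) = ennreal W"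
    unfolding f_def W(2)[symmetric] by (rule nn_integral_abs_restricted_weight[OF w]) simp
  have f_all: "(\<integral>\<^sup>+y. ennreal \<bar>f y\<bar> \<partial>lebesgue) = ennreal W"
    unfolding f_Q[symmetric] by (intro nn_integral_cong) (auto simp: f_def split: split_indicator)
  define V where "V = h ^ CARD('n)"
  have V: "0 < V" "emeasure lebesgue (cell 0 a) = ennreal V" "emeasure lebesgue Q = ennreal V"
    using h_pos unfolding V_def emeasure_cell ah(1) by (simp_all add: emeasure_cube del: emeasure_completion)
  define l where "l = W / V"
  have l: "0 < l" "avg (cell 0 a) (\<lambda>y. ennreal \<bar>f y\<bar>) = ennreal l"
    using W V by (simp_all add: l_def avg_def cell_Q f_Q divide_ennreal)
  let ?c = "2 ^ CARD('n) :: real"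
  let ?pos = "\<lambda>x. ennreal (ln (w x / l)) * ennreal (w x) * indicator Q x"
  let ?neg = "\<lambda>x. ennreal (- ln (w x / l)) * ennreal (w x) * indicator Q x"
  have I: "(\<integral>\<^sup>+x\<in>Q. maximal f x \<partial>lebesgue) = ennreal (F * W)"
  proof -
    have "(\<integral>\<^sup>+x\<in>Q. maximal f x \<partial>lebesgue) / ennreal W = ennreal F"
      using F unfolding fw_ratio_def \<mu>Q f_def by simp
    then have "(\<integral>\<^sup>+x\<in>Q. maximal f x \<partial>lebesgue) / ennreal W * ennreal W = ennreal F * ennreal W"
      by simp
    then show ?thesis
      using W F by (simp add: ennreal_divide_times ennreal_mult)
  qed
  have "(\<integral>\<^sup>+x\<in>Q. ennreal (ln (\<bar>f x\<bar> / l)) * ennreal \<bar>f x\<bar> \<partial>lebesgue) = (\<integral>\<^sup>+x. ?pos x \<partial>lebesgue)"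
    using AE_weight_pos[OF w]
    by (intro nn_integral_cong_AE, eventually_elim) (auto simp: f_def split: split_indicator)
  then have pos_le: "(\<integral>\<^sup>+x. ?pos x \<partial>lebesgue) + 2 ^ CARD('n) * ennreal W \<le> 2 ^ CARD('n) * ennreal (F * W)"
    using maximal_LlogL[of f a l] l W by (simp add: cell_Q f_Q f_all I)
  have c_eq: "(2 ^ CARD('n) :: ennreal) = ennreal ?c"
    by (simp flip: ennreal_power)
  have "(\<integral>\<^sup>+x. ?pos x \<partial>lebesgue) \<noteq> top"
    using pos_le F W unfolding c_eq by (auto simp: top_unique simp flip: ennreal_mult)
  then obtain p where p: "0 \<le> p" "(\<integral>\<^sup>+x. ?pos x \<partial>lebesgue) = ennreal p"
    by (cases "\<integral>\<^sup>+x. ?pos x \<partial>lebesgue") auto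
  have "ennreal (p + ?c * W) \<le> ennreal (?c * (F * W))"
    using pos_le p F W unfolding c_eq by (simp add: ennreal_mult)
  \<comment> \<open>Thus \<open>p\<close> is at most \<open>2 ^ CARD('n) * (F - 1) * W\<close>; as
    \<open>p\<close> is nonnegative, \<open>1 \<le> F\<close> follows too.\<close>
  then have p_le: "p + ?c * W \<le> ?c * (F * W)"
    using F W by (subst (asm) ennreal_le_iff) auto
  then have "?c * W \<le> ?c * (F * W)"
    using p by linarith
  then show F1: "1 \<le> F"
    using W by simp
  \<comment> \<open>This is \<open>t * ln t \<ge> t - 1\<close> for \<open>t = w x / l\<close>,
    multiplied by \<open>l\<close> and rearranged so that every term is nonnegative. After
    integration the two extra terms both equal \<open>W\<close> and cancel.\<close>
  have "AE x in lebesgue. ?neg x + ennreal (w x) * indicator Q x \<le> ?pos x + ennreal l * indicator Q x"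
    using AE_weight_pos[OF w]
  proof eventually_elim
    case (elim x)
    have "ln (l / w x) \<le> l / w x - 1"
      using elim l by (intro ln_le_minus_one) simp
    then have "w x * (1 - l / w x) \<le> w x * ln (w x / l)"
      using elim l by (intro mult_left_mono) (auto simp: ln_div)
    then have *: "w x - l \<le> w x * ln (w x / l)"
      using elim by (simp add: right_diff_distrib)
    show ?case
    proof (cases "0 \<le> ln (w x / l)")
      case True
      have "ennreal (w x) \<le> ennreal (ln (w x / l) * w x + l)"
        using * by (intro ennreal_leI) (simp add: mult.commute)
      then show ?thesis
        using True elim l by (auto simp: ennreal_neg ennreal_mult split: split_indicator)
    next
      case False
      have "ennreal (- ln (w x / l) * w x + w x) \<le> ennreal l"
        using * by (intro ennreal_leI) (simp add: mult.commute)
      moreover have "ennreal (- ln (w x / l) * w x + w x) = ennreal (- ln (w x / l)) * ennreal (w x) + ennreal (w x)"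
      proof -
        have "0 \<le> - ln (w x / l)" "0 \<le> w x"
          using False elim by auto
        then show ?thesis
          by (simp only: ennreal_plus ennreal_mult mult_nonneg_nonneg)
      qed
      ultimately show ?thesis
        by (auto intro: add_increasing split: split_indicator)
    qed
  qed
  then have "(\<integral>\<^sup>+x. ?neg x + ennreal (w x) * indicator Q x \<partial>lebesgue)
      \<le> (\<integral>\<^sup>+x. ?pos x + ennreal l * indicator Q x \<partial>lebesgue)"
    by (rule nn_integral_mono_AE)
  then have "(\<integral>\<^sup>+x. ?neg x \<partial>lebesgue) + ennreal W \<le> ennreal p + ennreal l * ennreal V"
    by (simp add: nn_integral_add nn_integral_cmult_indicator W p V)
  also have "ennreal l * ennreal V = ennreal W"
    using V W by (simp add: l_def flip: ennreal_mult)
  finally have neg_le: "(\<integral>\<^sup>+x. ?neg x \<partial>lebesgue) \<le> ennreal p"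
    by (simp add: add.commute[of _ "ennreal W"] ennreal_add_left_cancel_le)
  have "(\<integral>\<^sup>+x\<in>Q. ennreal \<bar>ln (w x) - ln l\<bar> \<partial>wmeasure w) = (\<integral>\<^sup>+x. ?pos x + ?neg x \<partial>lebesgue)"
    unfolding nn_integral_wmeasure[OF w Q_sets, of "\<lambda>x. ennreal \<bar>ln (w x) - ln l\<bar>", simplified]
    using AE_weight_pos[OF w]
    by (intro nn_integral_cong_AE, eventually_elim)
      (use l(1) in \<open>auto simp: ln_div abs_if ennreal_neg split: split_indicator\<close>)
  also have "\<dots> \<le> ennreal p + ennreal p"
    using neg_le by (simp add: nn_integral_add p)
  also have "\<dots> = ennreal (2 * p)"
    using p by (simp flip: ennreal_plus)
  finally have T: "(\<integral>\<^sup>+x\<in>Q. ennreal \<bar>ln (w x) - ln l\<bar> \<partial>wmeasure w) \<le> ennreal (2 * p)" .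
  note osc = wosc_le[OF w Q _ T _ \<mu>Q W(1)]
  show "set_integrable (wmeasure w) Q (\<lambda>x. ln (w x))"
    using p by (intro osc(1)) auto
  have "wosc w Q (\<lambda>x. ln (w x)) \<le> ennreal (2 * (2 * p) / W)"
    using p by (intro osc(2)) auto
  \<comment> \<open>The factor reached is \<open>4 * 2 ^ CARD('n)\<close>: one \<open>2\<close> for
    the two signs of the logarithm, one for passing from \<open>ln l\<close> to the mean. It is then
    enlarged to \<open>8 * 2 ^ CARD('n)\<close>.\<close>
  also have "\<dots> \<le> ennreal (2 ^ (CARD('n) + 3) * (F - 1))"
  proof (rule ennreal_leI)
    have "2 * (2 * p) \<le> 4 * (?c * (F - 1)) * W"
      using p_le by (simp add: algebra_simps)
    then have "2 * (2 * p) / W \<le> 4 * (?c * (F - 1))"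
      using W(1) by (simp only: pos_divide_le_eq)
    also have "\<dots> \<le> 8 * (?c * (F - 1))"
      using F1 by (intro mult_right_mono) auto
    finally show "2 * (2 * p) / W \<le> 2 ^ (CARD('n) + 3) * (F - 1)"
      by (simp add: power_add)
  qed
  finally show "wosc w Q (\<lambda>x. ln (w x)) \<le> ennreal (2 ^ (CARD('n) + 3) * (F - 1))" .
qed

section \<open>From single cubes to the norm and to local integrability\<close>

lemma compact_subset_cube:
  fixes K :: "(real^'n) set"
  assumes "compact K"
  obtains Q where "Q \<in> cubes" "K \<subseteq> Q"
proof -
  obtain b where b: "0 < b" "\<And>x. x \<in> K \<Longrightarrow> norm x \<le> b"
    using compact_imp_bounded[OF assms] unfolding bounded_pos by blast
  let ?Q = "cbox (\<chi> i. - b) ((\<chi> i. - b) + (\<chi> i. 2 * b)) :: (real^'n) set"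
  have "?Q \<in> cubes"
    using b(1) unfolding cubes_def by (auto intro!: exI[of _ "2 * b"])
  moreover have "K \<subseteq> ?Q"
  proof
    fix x assume "x \<in> K"
    then have "\<bar>x $ i\<bar> \<le> b" for i
      using b(2) order_trans[OF component_le_norm_cart] by blast
    then have "- b \<le> x $ i \<and> x $ i \<le> - b + 2 * b" for i
      by (smt (verit))
    then show "x \<in> ?Q"
      by (simp add: mem_box_cart)
  qed
  ultimately show thesis by (rule that)
qed

text \<open>In \<open>ereal\<close>, subtracting \<open>1\<close> is not truncated at
  \<open>0\<close>. The condition \<open>1 \<le> r\<close> keeps the real bound nonnegative, so
  \<open>ennreal\<close> does not alter it.\<close>

lemma enn2ereal_le_scaled_excess:
  assumes "x \<le> ennreal (2 ^ m * (r - 1))" "1 \<le> r"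
  shows "enn2ereal x \<le> 2 ^ m * (enn2ereal (ennreal r) - 1)"
proof -
  have "enn2ereal x \<le> enn2ereal (ennreal (2 ^ m * (r - 1)))"
    using assms(1) by (simp add: less_eq_ennreal.rep_eq)
  also have "\<dots> = ereal (2 ^ m * (r - 1))"
    using assms(2) by (simp add: enn2ereal_ennreal)
  also have "\<dots> = ereal 2 ^ m * (ereal r - 1)"
    by (simp add: one_ereal_def)
  also have "\<dots> = 2 ^ m * (enn2ereal (ennreal r) - 1)"
    using assms(2) by (simp add: enn2ereal_ennreal)
  finally show ?thesis .
qed

theorem corollary3p5:
  fixes w :: "real^'n \<Rightarrow> real"
  assumes "w \<in> A_infinity"
  shows "(\<lambda>x. ln (w x)) \<in> BMO w
    \<and> enn2ereal (bmo_norm w (\<lambda>x. ln (w x)))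
        \<le> 2 ^ (CARD('n) + 3) * (enn2ereal (fujii_wilson w) - 1)
    \<and> (\<forall>Q\<in>cubes. enn2ereal (wosc w Q (\<lambda>x. ln (w x)))
        \<le> 2 ^ (CARD('n) + 3) * (enn2ereal (fw_ratio w Q) - 1))"
proof -
  have w: "is_weight w"
    using assms by (auto simp: A_infinity_def A_class_def)
  obtain B where B: "\<And>Q. Q \<in> cubes \<Longrightarrow> fw_ratio w Q \<le> ennreal B"
    using fw_ratio_bounded[OF assms] by blast
  have "fujii_wilson w \<le> ennreal B"
    unfolding fujii_wilson_def by (intro SUP_least B)
  \<comment> \<open>A finite supremum makes the ratio of every cube a real number, as
    \<open>log_oscillation\<close> requires.\<close>
  then obtain A where A: "0 \<le> A" "fujii_wilson w = ennreal A"
    by (cases "fujii_wilson w") (auto simp: top_unique)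
  have ratio: "\<exists>F. 0 \<le> F \<and> fw_ratio w Q = ennreal F \<and> F \<le> A" if "Q \<in> cubes" for Q
  proof -
    have "fw_ratio w Q \<le> ennreal A"
      unfolding A(2)[symmetric] fujii_wilson_def using that by (rule SUP_upper)
    then show ?thesis
      using A(1) by (cases "fw_ratio w Q") (auto simp: top_unique)
  qed
  obtain Q0 :: "(real^'n) set" where Q0: "Q0 \<in> cubes"
    using compact_subset_cube[OF compact_empty] by blast
  \<comment> \<open>One cube suffices: its ratio is at least \<open>1\<close> and at most
    \<open>A\<close>.\<close>
  have A1: "1 \<le> A"
    using ratio[OF Q0] log_oscillation(2)[OF w Q0] by fastforce
  have osc: "wosc w Q (\<lambda>x. ln (w x)) \<le> ennreal (2 ^ (CARD('n) + 3) * (A - 1))" if Q: "Q \<in> cubes" for Q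
  proof -
    obtain F where F: "0 \<le> F" "fw_ratio w Q = ennreal F" "F \<le> A"
      using ratio[OF Q] by blast
    have "wosc w Q (\<lambda>x. ln (w x)) \<le> ennreal (2 ^ (CARD('n) + 3) * (F - 1))"
      by (rule log_oscillation(3)[OF w Q F(2,1)])
    also have "\<dots> \<le> ennreal (2 ^ (CARD('n) + 3) * (A - 1))"
      using F(3) by (intro ennreal_leI mult_left_mono) auto
    finally show ?thesis .
  qed
  then have norm: "bmo_norm w (\<lambda>x. ln (w x)) \<le> ennreal (2 ^ (CARD('n) + 3) * (A - 1))"
    unfolding bmo_norm_def by (intro SUP_least)
  have "loc_integrable (wmeasure w) (\<lambda>x. ln (w x))"
    unfolding loc_integrable_def
  proof (intro allI impI)
    fix K :: "(real^'n) set" assume K: "compact K"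
    then obtain Q where Q: "Q \<in> cubes" "K \<subseteq> Q"
      using compact_subset_cube by blast
    obtain F where "0 \<le> F" "fw_ratio w Q = ennreal F"
      using ratio[OF Q(1)] by blast
    then have "set_integrable (wmeasure w) Q (\<lambda>x. ln (w x))"
      by (intro log_oscillation(1)[OF w Q(1)])
    moreover have "K \<in> sets (wmeasure w)"
      using K by (simp add: borel_closed compact_imp_closed sets_completionI_sets)
    ultimately show "set_integrable (wmeasure w) K (\<lambda>x. ln (w x))"
      using Q(2) by (rule set_integrable_subset)
  qed
  moreover have "bmo_norm w (\<lambda>x. ln (w x)) < \<infinity>"
    using norm by (rule le_less_trans) simp
  moreover have "enn2ereal (wosc w Q (\<lambda>x. ln (w x))) \<le> 2 ^ (CARD('n) + 3) * (enn2ereal (fw_ratio w Q) - 1)"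
    if Q: "Q \<in> cubes" for Q
  proof -
    obtain F where F: "0 \<le> F" "fw_ratio w Q = ennreal F"
      using ratio[OF Q] by blast
    show ?thesis
      unfolding F(2) by (intro enn2ereal_le_scaled_excess log_oscillation[OF w Q F(2,1)])
  qed
  ultimately show ?thesis
    using enn2ereal_le_scaled_excess[OF norm A1] unfolding BMO_def A(2) by blast
qed

end
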